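(* Let $\Pi$ be a polar space of rank $n\ge3$ and let $k,l,m$ be natural numbers with $0<m\le k$, $l\le n$ and $3\le l-m\le n-k$. Let $\mathcal X\subset\mathcal G_k(\Pi)$ be such that the restriction $\Gamma(\mathcal X)$ of $\Gamma_k(\Pi)$ to $\mathcal X$ is isomorphic to $PJ(l,m)$ and every maximal clique of $\Gamma(\mathcal X)$ is an independent subset of $\mathfrak G_k(\Pi)$. Suppose that either (1) $m+2>n-k$, or (2) $l-m\ge4$ and $\mathcal X$ is not contained in any big star $[S\rangle_k$, $S\in\mathcal G_{k-1}(\Pi)$. Then there exists a $(k-m-1)$-dimensional singular subspace $N$ such that $\mathcal X\subset[N\rangle_k$, and there exists an $l$-frame $\mathcal B$ of the polar space $[N\rangle_{k-m}$ such that every element of $\mathcal X$ is spanned (as a subspace of $\Pi$) by elements of $\mathcal B$.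
   Context: Polar space $\Pi$ of rank $n$: partial linear space with lines of $\ge3$ points, no point collinear with all others, each point collinear with one or all points of a line, finite flags of singular subspaces; maximal singular subspaces are $(n-1)$-dimensional projective spaces. $\mathcal G_j(\Pi)$: $j$-dimensional singular subspaces ($\dim\emptyset=-1$). For $j\le n-2$, $S,U\in\mathcal G_j(\Pi)$ are adjacent if $\dim(S\cap U)=j-1$ and every point of $S$ is collinear with every point of $U$; this gives $\Gamma_j(\Pi)$. $[S,U]_j=\{X\in\mathcal G_j(\Pi):S\subset X\subset U\}$, $[S\rangle_j=\{X\in\mathcal G_j(\Pi):S\subset X\}$. The Grassmann space $\mathfrak G_k(\Pi)$ has points $\mathcal G_k(\Pi)$ and lines $[S,U]_k$, $S\in\mathcal G_{k-1}(\Pi)$, $U\in\mathcal G_{k+1}(\Pi)$, $S\subset U$. A subset $Z$ of a partial linear space is independent if the subspace it spans is not spanned by a proper subset. For a $(k-m-1)$-dimensional singular subspace $N$, $[N\rangle_{k-m}$ with lines $[S,U]_{k-m}$ ($N\subset S$) is a polar space of rank $n-k+m$; an $l$-frame of it is a set of $2l$ distinct points each non-collinear with exactly one other point of the set. Polar Johnson graph $PJ(l,m)$: with $J=\{\pm1,\dots,\pm l\}$, singular subsets are those not containing both $j$ and $-j$; vertices are singular $(m+1)$-subsets, adjacent when they share $m$ elements and (if $m\le l-2$) their union is singular. *)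

theory Defs
  imports Main
begin

text \<open>A point-line geometry is given by a point set \<open>P\<close> and a set of lines \<open>L\<close>, each line being
  a set of points. A point counts as collinear with itself.\<close>

definition pls_collinear :: "'a set set \<Rightarrow> 'a \<Rightarrow> 'a \<Rightarrow> bool" where
  "pls_collinear L p q \<longleftrightarrow> p = q \<or> (\<exists>l\<in>L. p \<in> l \<and> q \<in> l)"

definition pls_subspace :: "'a set \<Rightarrow> 'a set set \<Rightarrow> 'a set \<Rightarrow> bool" where
  "pls_subspace P L S \<longleftrightarrow>
     S \<subseteq> P \<and> (\<forall>l\<in>L. \<forall>p\<in>S. \<forall>q\<in>S. p \<noteq> q \<and> p \<in> l \<and> q \<in> l \<longrightarrow> l \<subseteq> S)"

definition pls_span :: "'a set \<Rightarrow> 'a set set \<Rightarrow> 'a set \<Rightarrow> 'a set" where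
  "pls_span P L Z = \<Inter>{S. pls_subspace P L S \<and> Z \<subseteq> S}"

definition pls_independent :: "'a set \<Rightarrow> 'a set set \<Rightarrow> 'a set \<Rightarrow> bool" where
  "pls_independent P L Z \<longleftrightarrow>
     Z \<subseteq> P \<and> (\<forall>Y. Y \<subset> Z \<longrightarrow> pls_span P L Y \<noteq> pls_span P L Z)"

text \<open>The projective dimension: one less than the size of a base, so that the empty subspace has
  dimension \<open>-1\<close>. Stated as a relation; it is only used for singular subspaces of polar spaces,
  which are projective spaces, so that all their bases have the same size.\<close>

definition pls_has_dim :: "'a set \<Rightarrow> 'a set set \<Rightarrow> 'a set \<Rightarrow> int \<Rightarrow> bool" where
  "pls_has_dim P L S d \<longleftrightarrow>
     (\<exists>B. finite B \<and> pls_independent P L B \<and> pls_span P L B = S \<and> int (card B) = d + 1)"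

definition singular_subspace :: "'a set \<Rightarrow> 'a set set \<Rightarrow> 'a set \<Rightarrow> bool" where
  "singular_subspace P L S \<longleftrightarrow>
     pls_subspace P L S \<and> (\<forall>p\<in>S. \<forall>q\<in>S. pls_collinear L p q)"

definition maximal_singular_subspace :: "'a set \<Rightarrow> 'a set set \<Rightarrow> 'a set \<Rightarrow> bool" where
  "maximal_singular_subspace P L M \<longleftrightarrow>
     singular_subspace P L M \<and> (\<forall>S. singular_subspace P L S \<and> M \<subseteq> S \<longrightarrow> S = M)"

locale partial_linear_space =
  fixes P :: "'a set" and L :: "'a set set"
  assumes line_subset: "l \<in> L \<Longrightarrow> l \<subseteq> P"
    and line_two_points: "l \<in> L \<Longrightarrow> \<exists>A\<subseteq>l. card A = 2"
    and line_unique: "\<lbrakk>l \<in> L; l' \<in> L; p \<noteq> q; p \<in> l; q \<in> l; p \<in> l'; q \<in> l'\<rbrakk> \<Longrightarrow> l = l'"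

text \<open>The last axiom is the Veblen-Young axiom: if the lines \<open>ab\<close> and \<open>cd\<close> meet, then so do
  \<open>ac\<close> and \<open>bd\<close>.\<close>

locale projective_space = partial_linear_space +
  assumes all_collinear: "\<lbrakk>p \<in> P; q \<in> P\<rbrakk> \<Longrightarrow> pls_collinear L p q"
    and line_three_points: "l \<in> L \<Longrightarrow> \<exists>A\<subseteq>l. card A = 3"
    and veblen_young:
      "\<lbrakk>distinct [a, b, c, d]; ab \<in> L; cd \<in> L; ac \<in> L; bd \<in> L;
        a \<in> ab; b \<in> ab; c \<in> cd; d \<in> cd; a \<in> ac; c \<in> ac; b \<in> bd; d \<in> bd; ab \<inter> cd \<noteq> {}\<rbrakk>
       \<Longrightarrow> ac \<inter> bd \<noteq> {}"

locale polar_space = partial_linear_space +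
  fixes n :: nat
  assumes line_three_points: "l \<in> L \<Longrightarrow> \<exists>A\<subseteq>l. card A = 3"
    and no_radical: "p \<in> P \<Longrightarrow> \<exists>q\<in>P. \<not> pls_collinear L p q"
    and one_or_all:
      "\<lbrakk>p \<in> P; l \<in> L\<rbrakk> \<Longrightarrow>
         (\<exists>!q. q \<in> l \<and> pls_collinear L p q) \<or> (\<forall>q\<in>l. pls_collinear L p q)"
    and finite_flags: "subset.chain {S. singular_subspace P L S} C \<Longrightarrow> finite C"
    and rank_projective:
      "maximal_singular_subspace P L M \<Longrightarrow> projective_space M {l \<in> L. l \<subseteq> M}"
    and rank_dim: "maximal_singular_subspace P L M \<Longrightarrow> pls_has_dim P L M (int n - 1)"

text \<open>The Grassmannian \<open>\<G>\<^sub>j\<close>. The index is an integer because \<open>j = -1\<close> occurs.\<close>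

definition polar_grassmannian :: "'a set \<Rightarrow> 'a set set \<Rightarrow> int \<Rightarrow> 'a set set" where
  "polar_grassmannian P L j = {S. singular_subspace P L S \<and> pls_has_dim P L S j}"

definition grass_interval :: "'a set \<Rightarrow> 'a set set \<Rightarrow> int \<Rightarrow> 'a set \<Rightarrow> 'a set \<Rightarrow> 'a set set" where
  "grass_interval P L j S U = {X \<in> polar_grassmannian P L j. S \<subseteq> X \<and> X \<subseteq> U}"

definition grass_star :: "'a set \<Rightarrow> 'a set set \<Rightarrow> int \<Rightarrow> 'a set \<Rightarrow> 'a set set" where
  "grass_star P L j S = {X \<in> polar_grassmannian P L j. S \<subseteq> X}"

definition grass_lines :: "'a set \<Rightarrow> 'a set set \<Rightarrow> int \<Rightarrow> 'a set set set" where
  "grass_lines P L j =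
     {grass_interval P L j S U | S U.
        S \<in> polar_grassmannian P L (j - 1) \<and> U \<in> polar_grassmannian P L (j + 1) \<and> S \<subseteq> U}"

definition grass_star_lines :: "'a set \<Rightarrow> 'a set set \<Rightarrow> int \<Rightarrow> 'a set \<Rightarrow> 'a set set set" where
  "grass_star_lines P L j N =
     {grass_interval P L j S U | S U.
        S \<in> polar_grassmannian P L (j - 1) \<and> U \<in> polar_grassmannian P L (j + 1) \<and>
        N \<subseteq> S \<and> S \<subseteq> U}"

text \<open>Adjacency in the graph \<open>\<Gamma>\<^sub>j\<close> for \<open>j \<le> n - 2\<close>, where \<open>n\<close> is the rank. (For maximal singular
  subspaces, \<open>j = n - 1\<close>, adjacency is defined differently.)\<close>

definition grass_adj :: "'a set \<Rightarrow> 'a set set \<Rightarrow> int \<Rightarrow> 'a set \<Rightarrow> 'a set \<Rightarrow> bool" where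
  "grass_adj P L j S U \<longleftrightarrow>
     S \<in> polar_grassmannian P L j \<and> U \<in> polar_grassmannian P L j \<and>
     pls_has_dim P L (S \<inter> U) (j - 1) \<and> (\<forall>p\<in>S. \<forall>q\<in>U. pls_collinear L p q)"

definition point_frame :: "'a set \<Rightarrow> 'a set set \<Rightarrow> nat \<Rightarrow> 'a set \<Rightarrow> bool" where
  "point_frame P L l B \<longleftrightarrow>
     B \<subseteq> P \<and> finite B \<and> card B = 2 * l \<and>
     (\<forall>p\<in>B. \<exists>!q. q \<in> B \<and> q \<noteq> p \<and> \<not> pls_collinear L p q)"

text \<open>Graphs are given by a vertex set and an adjacency relation, which is only considered
  on that vertex set.\<close>

definition graph_isomorphic ::
  "'a set \<Rightarrow> ('a \<Rightarrow> 'a \<Rightarrow> bool) \<Rightarrow> 'b set \<Rightarrow> ('b \<Rightarrow> 'b \<Rightarrow> bool) \<Rightarrow> bool" where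
  "graph_isomorphic V E W F \<longleftrightarrow>
     (\<exists>f. bij_betw f V W \<and> (\<forall>x\<in>V. \<forall>y\<in>V. E x y \<longleftrightarrow> F (f x) (f y)))"

definition graph_clique :: "'a set \<Rightarrow> ('a \<Rightarrow> 'a \<Rightarrow> bool) \<Rightarrow> 'a set \<Rightarrow> bool" where
  "graph_clique V E C \<longleftrightarrow> C \<subseteq> V \<and> (\<forall>x\<in>C. \<forall>y\<in>C. x \<noteq> y \<longrightarrow> E x y)"

definition maximal_graph_clique :: "'a set \<Rightarrow> ('a \<Rightarrow> 'a \<Rightarrow> bool) \<Rightarrow> 'a set \<Rightarrow> bool" where
  "maximal_graph_clique V E C \<longleftrightarrow>
     graph_clique V E C \<and> (\<forall>D. graph_clique V E D \<and> C \<subseteq> D \<longrightarrow> D = C)"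

definition PJ_singular :: "nat \<Rightarrow> int set \<Rightarrow> bool" where
  "PJ_singular l A \<longleftrightarrow> A \<subseteq> {j. 1 \<le> \<bar>j\<bar> \<and> \<bar>j\<bar> \<le> int l} \<and> (\<forall>j\<in>A. - j \<notin> A)"

definition PJ_verts :: "nat \<Rightarrow> nat \<Rightarrow> int set set" where
  "PJ_verts l m = {A. PJ_singular l A \<and> card A = m + 1}"

definition PJ_adj :: "nat \<Rightarrow> nat \<Rightarrow> int set \<Rightarrow> int set \<Rightarrow> bool" where
  "PJ_adj l m A B \<longleftrightarrow>
     A \<in> PJ_verts l m \<and> B \<in> PJ_verts l m \<and> card (A \<inter> B) = m \<and>
     (m + 2 \<le> l \<longrightarrow> PJ_singular l (A \<union> B))"

end

theory Submission imports Defs begin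

text \<open>Singular subspaces have a rank that behaves as in projective geometry. Three pairwise adjacent
  \<open>X, Y, Z\<close> satisfy \<open>X \<inter> Y \<subseteq> Z\<close> (star) or \<open>Z \<subseteq> X \<squnion> Y\<close> (top), and independence excludes having both.
  Non-adjacent vertices of the polar Johnson graph force the vertices \<open>A \<union> {i}\<close> over a fixed
  \<open>m\<close>-set \<open>A\<close> to form stars; the vertices inside a fixed \<open>(m+2)\<close>-set \<open>B\<close> form tops, since
  otherwise they lie in a star, which is too small for an independent set of \<open>m+2\<close> (case 1) or swallows all of \<open>\<X>\<close> (case 2). So the
  images of \<open>B - {b}\<close> are \<open>m+2\<close> independent hyperplanes of a singular subspace of rank \<open>k+2\<close>. The
  intersection of those with \<open>b \<notin> C\<close> has rank \<open>k-m+|C|\<close> and depends only on \<open>C\<close>; the empty set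
  gives \<open>N\<close> and the singletons give the frame.\<close>

section \<open>Spans and independence\<close>

text \<open>Spans in the Grassmann space have no handy description, so its independence is first
  turned into rank statements. The bridge is one inclusion for each type of clique: a Grassmann
  subspace containing a family from a star contains every star member inside the join of the family,
  and one containing a family of hyperplanes of a top contains every hyperplane through their
  intersection. Hence each new member of an independent family raises the rank of the join by one in
  a star, and lowers the rank of the intersection by one in a top. The first count gives the bound
  used in case 1, the second gives \<open>(k + 2) - (m + 2 - |C|) = k - m + |C|\<close>. The
  obstacle is that \<open>i\<close> and \<open>- i\<close> never occur in one clique, so clique
  arguments cannot compare them directly. They are compared through an auxiliary index, and
  \<open>l - m \<ge> 3\<close> leaves one outside every \<open>(m + 2)\<close>-set. It also makes
  adjacency demand a singular union, which is why opposite frame points turn out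
  non-collinear.\<close>

lemma span_superset: "Z \<subseteq> pls_span P L Z"
  by (auto simp: pls_span_def)

lemma span_least: "pls_subspace P L S \<Longrightarrow> Z \<subseteq> S \<Longrightarrow> pls_span P L Z \<subseteq> S"
  by (auto simp: pls_span_def)

lemma span_mono: "Y \<subseteq> Z \<Longrightarrow> pls_span P L Y \<subseteq> pls_span P L Z"
  by (auto simp: pls_span_def)

lemma span_of_subspace: "pls_subspace P L S \<Longrightarrow> pls_span P L S = S"
  by (simp add: antisym span_least span_superset)

lemma singular_is_subspace: "singular_subspace P L S \<Longrightarrow> pls_subspace P L S"
  by (simp add: singular_subspace_def)

lemma subspace_carrier: "pls_subspace P L S \<Longrightarrow> S \<subseteq> P"
  by (simp add: pls_subspace_def)

lemma subspace_line:
  "pls_subspace P L S \<Longrightarrow> l \<in> L \<Longrightarrow> p \<in> S \<Longrightarrow> q \<in> S \<Longrightarrow> p \<noteq> q \<Longrightarrow> p \<in> l \<Longrightarrow> q \<in> l \<Longrightarrow> l \<subseteq> S"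
  unfolding pls_subspace_def by blast

lemma subspace_Inter:
  assumes "\<A> \<noteq> {}" and sub: "\<And>S. S \<in> \<A> \<Longrightarrow> pls_subspace P L S"
  shows "pls_subspace P L (\<Inter>\<A>)"
  unfolding pls_subspace_def
proof (intro conjI ballI impI)
  show "\<Inter>\<A> \<subseteq> P" using assms subspace_carrier by blast
  fix l p q assume "l \<in> L" "p \<in> \<Inter>\<A>" "q \<in> \<Inter>\<A>" "p \<noteq> q \<and> p \<in> l \<and> q \<in> l"
  then show "l \<subseteq> \<Inter>\<A>" using subspace_line[OF sub] by (meson Inter_greatest InterE)
qed

lemma subspace_Int: "pls_subspace P L S \<Longrightarrow> pls_subspace P L T \<Longrightarrow> pls_subspace P L (S \<inter> T)"
  using subspace_Inter[of "{S, T}" P L] by auto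

lemma singular_Int:
  "singular_subspace P L S \<Longrightarrow> pls_subspace P L T \<Longrightarrow> singular_subspace P L (S \<inter> T)"
  by (simp add: singular_subspace_def subspace_Int)

lemma singular_subset:
  "singular_subspace P L U \<Longrightarrow> pls_subspace P L S \<Longrightarrow> S \<subseteq> U \<Longrightarrow> singular_subspace P L S"
  by (auto simp: singular_subspace_def)

text \<open>By monotonicity of spans only the subsets missing a single element need testing.\<close>

lemma independent_iff:
  "pls_independent P L Z \<longleftrightarrow> Z \<subseteq> P \<and> (\<forall>z\<in>Z. z \<notin> pls_span P L (Z - {z}))"
proof -
  have "z \<notin> pls_span P L (Z - {z})"
    if "\<forall>Y. Y \<subset> Z \<longrightarrow> pls_span P L Y \<noteq> pls_span P L Z" "z \<in> Z" for z
  proof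
    assume z: "z \<in> pls_span P L (Z - {z})"
    have "pls_span P L (Z - {z}) = pls_span P L Z"
      using z unfolding pls_span_def by auto
    with that show False by blast
  qed
  moreover have "pls_span P L Y \<noteq> pls_span P L Z"
    if h: "\<forall>z\<in>Z. z \<notin> pls_span P L (Z - {z})" "Y \<subset> Z" for Y
  proof -
    obtain z where z: "z \<in> Z" "z \<notin> Y" using h(2) by blast
    then have "pls_span P L Y \<subseteq> pls_span P L (Z - {z})" using h(2) by (intro span_mono) blast
    moreover have "z \<in> pls_span P L Z" using z span_superset[of Z P L] by blast
    ultimately show ?thesis using h(1) z by blast
  qed
  ultimately show ?thesis unfolding pls_independent_def by blast
qed

lemma collinear_sym: "pls_collinear L p q \<longleftrightarrow> pls_collinear L q p"
  by (auto simp: pls_collinear_def)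

section \<open>Rank of singular subspaces\<close>

context polar_space
begin

abbreviation sp :: "'a set \<Rightarrow> 'a set" where "sp \<equiv> pls_span P L"
abbreviation subsp :: "'a set \<Rightarrow> bool" where "subsp \<equiv> pls_subspace P L"
abbreviation sing :: "'a set \<Rightarrow> bool" where "sing \<equiv> singular_subspace P L"
abbreviation indep :: "'a set \<Rightarrow> bool" where "indep \<equiv> pls_independent P L"
abbreviation col :: "'a \<Rightarrow> 'a \<Rightarrow> bool" where "col \<equiv> pls_collinear L"

lemma in_sp: "z \<in> Z \<Longrightarrow> z \<in> sp Z"
  using span_superset by (rule subsetD)

lemma sp_subsp: "Z \<subseteq> P \<Longrightarrow> subsp (sp Z)"
  unfolding pls_span_def
  by (rule subspace_Inter) (use line_subset in \<open>auto simp: pls_subspace_def\<close>)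

text \<open>Two points of a line collinear with \<open>p\<close> rule out the "exactly one"
  alternative of the one-or-all axiom.\<close>

lemma perp_subsp:
  assumes "p \<in> P" shows "subsp {q \<in> P. col p q}"
  unfolding pls_subspace_def
proof (intro conjI ballI impI)
  fix l q r assume h: "l \<in> L" "q \<in> {q \<in> P. col p q}" "r \<in> {q \<in> P. col p q}" "q \<noteq> r \<and> q \<in> l \<and> r \<in> l"
  then have "\<forall>q\<in>l. col p q" using one_or_all[OF assms \<open>l \<in> L\<close>] by blast
  then show "l \<subseteq> {q \<in> P. col p q}" using line_subset[OF \<open>l \<in> L\<close>] by blast
qed auto

lemma sp_perp:
  assumes "Y \<subseteq> P" "Z \<subseteq> P" and c: "\<And>p q. p \<in> Y \<Longrightarrow> q \<in> Z \<Longrightarrow> col p q"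
    and "p \<in> Y" "q \<in> sp Z"
  shows "col p q"
proof -
  have "sp Z \<subseteq> {q \<in> P. col p q}"
    using assms by (intro span_least perp_subsp) auto
  then show ?thesis using assms by auto
qed

text \<open>Collinearity passes to the span in one argument at a time, so \<open>sp_perp\<close> is
  applied twice.\<close>

lemma sp_sing:
  assumes "Z \<subseteq> P" and c: "\<And>p q. p \<in> Z \<Longrightarrow> q \<in> Z \<Longrightarrow> col p q"
  shows "sing (sp Z)"
proof -
  have sub: "sp Z \<subseteq> P" using sp_subsp[OF assms(1)] by (rule subspace_carrier)
  have 1: "col p q" if "p \<in> Z" "q \<in> sp Z" for p q
    using sp_perp[OF assms(1,1) c] that by blast
  have "col p q" if "p \<in> sp Z" "q \<in> sp Z" for p q
    using sp_perp[OF sub assms(1)] 1 that by (metis collinear_sym)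
  then show ?thesis using sp_subsp[OF assms(1)] by (simp add: singular_subspace_def)
qed

text \<open>Finite flags make every chain finite, so its union is its largest member and Zorn's
  lemma applies. This opens the way to the axioms on projectivity and dimension, which speak of
  maximal singular subspaces.\<close>

lemma sing_in_maximal:
  assumes "sing S" obtains M where "maximal_singular_subspace P L M" "S \<subseteq> M"
proof -
  let ?A = "{T. sing T \<and> S \<subseteq> T}"
  have "\<exists>M\<in>?A. \<forall>X\<in>?A. M \<subseteq> X \<longrightarrow> X = M"
  proof (rule subset_Zorn_nonempty)
    show "?A \<noteq> {}" using assms by auto
    fix C assume C: "C \<noteq> {}" "subset.chain ?A C"
    then have ch: "subset.chain {T. sing T} C" unfolding subset_chain_def by auto
    have "\<Union>C \<in> C"
      using C finite_flags[OF ch] by (intro Union_in_chain) auto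
    then show "\<Union>C \<in> ?A" using C unfolding subset_chain_def by auto
  qed
  then obtain M where "M \<in> ?A" "\<forall>X\<in>?A. M \<subseteq> X \<longrightarrow> X = M" by blast
  then have "maximal_singular_subspace P L M" "S \<subseteq> M"
    unfolding maximal_singular_subspace_def by auto
  then show thesis by (rule that)
qed

section \<open>Joins inside a singular subspace as cones\<close>

lemma sing_veblen:
  assumes U: "sing U" "{a, b, c, d} \<subseteq> U" and "distinct [a, b, c, d]"
    and L: "ab \<in> L" "cd \<in> L" "ac \<in> L" "bd \<in> L"
    and i: "a \<in> ab" "b \<in> ab" "c \<in> cd" "d \<in> cd" "a \<in> ac" "c \<in> ac" "b \<in> bd" "d \<in> bd"
    and "ab \<inter> cd \<noteq> {}"
  shows "ac \<inter> bd \<noteq> {}"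
proof -
  obtain M where M: "maximal_singular_subspace P L M" "U \<subseteq> M"
    using sing_in_maximal[OF U(1)] .
  interpret M: projective_space M "{l \<in> L. l \<subseteq> M}"
    using rank_projective[OF M(1)] .
  have "subsp M" using M(1) by (simp add: maximal_singular_subspace_def singular_subspace_def)
  then have "ab \<subseteq> M" "cd \<subseteq> M" "ac \<subseteq> M" "bd \<subseteq> M"
    using subspace_line[OF \<open>subsp M\<close>] assms M(2) by (simp_all; blast)+
  then show ?thesis
    using M.veblen_young[OF assms(3), of ab cd ac bd] L i assms by blast
qed

lemma sing_line:
  assumes "sing U" "p \<in> U" "q \<in> U" "p \<noteq> q" obtains l where "l \<in> L" "p \<in> l" "q \<in> l" "l \<subseteq> U"
  using assms unfolding singular_subspace_def pls_collinear_def pls_subspace_def by metis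

text \<open>The cone with vertex \<open>p\<close> over \<open>S\<close> contains the line joining two of its points \<open>q1, q2\<close>: Veblen-Young
  makes \<open>l\<close> meet \<open>s1s2\<close>, and then makes \<open>px\<close> meet \<open>s1s2\<close>.\<close>

lemma cone_aux:
  assumes U: "sing U" "S \<subseteq> U" "subsp S" "p \<in> U" "p \<notin> S"
    and l1: "l1 \<in> L" "p \<in> l1" "q1 \<in> l1" "s1 \<in> l1" "s1 \<in> S"
    and l2: "l2 \<in> L" "p \<in> l2" "s1 \<noteq> s2" "s2 \<in> l2" "s2 \<in> S" "q2 \<in> l2"
    and l: "l \<in> L" "q1 \<in> l" "q2 \<in> l" "x \<in> l"
    and ne: "q1 \<noteq> p" "q2 \<noteq> p" "q1 \<noteq> q2" "l1 \<noteq> l2" "x \<noteq> q1" "x \<noteq> q2"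
  shows "\<exists>s\<in>S. \<exists>l\<in>L. p \<in> l \<and> x \<in> l \<and> s \<in> l"
proof -
  have sU: "subsp U" using U(1) by (rule singular_is_subspace)
  have "p \<noteq> s1" "p \<noteq> s2" using U l1 l2 by auto
  have "l1 \<subseteq> U" "l2 \<subseteq> U"
    using subspace_line[OF sU] U l1 l2 \<open>p \<noteq> s1\<close> \<open>p \<noteq> s2\<close> by blast+
  then have qU: "q1 \<in> U" "q2 \<in> U" using l1 l2 by auto
  then have xU: "x \<in> U" using subspace_line[OF sU l(1)] l ne by blast
  have nl: "l \<noteq> l1" "l \<noteq> l2"
    using line_unique[of l1 l2 p q2] line_unique[of l1 l2 p q1] l1 l2 l ne by blast+
  then have px: "p \<notin> l" using line_unique[of l l1 p q1] l l1 ne by blast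
  then have "p \<noteq> x" using l by auto
  obtain m where m: "m \<in> L" "p \<in> m" "x \<in> m" using sing_line[OF U(1,4) xU \<open>p \<noteq> x\<close>] by blast
  obtain t where t: "t \<in> L" "s1 \<in> t" "s2 \<in> t" "t \<subseteq> U"
    using sing_line[OF U(1), of s1 s2] U l1 l2 by blast
  have tS: "t \<subseteq> S" using subspace_line[OF U(3) t(1)] l1 l2 t by blast
  have l1l: "l1 \<inter> l = {q1}" "l2 \<inter> l = {q2}"
    using line_unique[of l1 l] line_unique[of l2 l] l1 l2 l nl by blast+
  have sub: "s1 \<in> U" "s2 \<in> U" using U l1 l2 by auto
  have "m \<inter> S \<noteq> {}"
  proof (cases "x \<in> S")
    case True then show ?thesis using m by auto
  next
    case False
    \<comment> \<open>Veblen-Young wants four distinct points. If \<open>q1 = s1\<close> or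
      \<open>q2 = s2\<close>, then \<open>l\<close> already meets \<open>t\<close> there, and one
      application is enough.\<close>
    show ?thesis
    proof (cases "q1 = s1 \<or> q2 = s2")
      case True
      then show ?thesis
      proof
        assume q: "q1 = s1"
        then have "x \<noteq> s2" "x \<noteq> s1" using False l1 l2 by auto
        then have "m \<inter> t \<noteq> {}"
          using sing_veblen[OF U(1), of p s2 x s1 l2 l m t] U l1 l2 l m t q xU sub
            \<open>p \<noteq> s1\<close> \<open>p \<noteq> s2\<close> \<open>p \<noteq> x\<close> by auto
        then show ?thesis using tS by auto
      next
        assume q: "q2 = s2"
        then have "x \<noteq> s2" "x \<noteq> s1" using False l1 l2 by auto
        then have "m \<inter> t \<noteq> {}"
          using sing_veblen[OF U(1), of p s1 x s2 l1 l m t] U l1 l2 l m t q xU sub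
            \<open>p \<noteq> s1\<close> \<open>p \<noteq> s2\<close> \<open>p \<noteq> x\<close> by auto
        then show ?thesis using tS by auto
      qed
    next
      case q: False
      have "y = p" if "y \<in> l1" "y \<in> l2" for y
        using line_unique[of l1 l2 y p] that l1(1,2) l2(1,2) ne(4) by blast
      then have "q1 \<noteq> q2" "q1 \<noteq> s2" "s1 \<noteq> q2" "s1 \<noteq> s2"
        using l1 l2 ne \<open>p \<noteq> s1\<close> \<open>p \<noteq> s2\<close> by blast+
      then have "distinct [q1, s1, q2, s2]" using q by auto
      moreover have "l1 \<inter> l2 \<noteq> {}" using l1 l2 by auto
      ultimately have "l \<inter> t \<noteq> {}"
        using sing_veblen[OF U(1), of q1 s1 q2 s2 l1 l2 l t] l1 l2 l t qU sub by auto
      then obtain y where y: "y \<in> l" "y \<in> t" by auto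
      have "y \<in> S" "y \<noteq> s1" "y \<noteq> x" "y \<noteq> p" using y tS q l1l l1 False U(5) by auto
      moreover have "x \<noteq> s1" using False l1 by auto
      moreover have "l1 \<inter> l \<noteq> {}" using l1l by auto
      ultimately have "m \<inter> t \<noteq> {}"
        using sing_veblen[OF U(1), of p s1 x y l1 l m t] U l1 l y m t xU sub
          \<open>p \<noteq> s1\<close> \<open>p \<noteq> x\<close> by auto
      then show ?thesis using tS by auto
    qed
  qed
  then show ?thesis using m by blast
qed

text \<open>The union of the lines joining \<open>p\<close> to points of \<open>S\<close> is itself
  closed under lines, so it is the whole span. Exchange and all rank computations rest on this
  description.\<close>

lemma sp_insert_line:
  assumes U: "sing U" "S \<subseteq> U" "subsp S" "p \<in> U" "p \<notin> S" and q: "q \<in> sp (insert p S)" "q \<noteq> p"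
  shows "\<exists>s\<in>S. \<exists>l\<in>L. p \<in> l \<and> q \<in> l \<and> s \<in> l"
proof -
  have sU: "subsp U" using U(1) by (rule singular_is_subspace)
  define T where "T = insert p {q. \<exists>s\<in>S. \<exists>l\<in>L. p \<in> l \<and> q \<in> l \<and> s \<in> l}"
  have pT: "x \<in> T" if a: "l \<in> L" "q \<noteq> p" "p \<in> l" "q \<in> l" "q \<in> T" "x \<in> l" for l q x
  proof -
    obtain s l' where s: "s \<in> S" "l' \<in> L" "p \<in> l'" "q \<in> l'" "s \<in> l'"
      using a unfolding T_def by auto
    then have "l = l'" using line_unique[of l l' p q] a by auto
    then show ?thesis using s a unfolding T_def by auto
  qed
  have "subsp T"
    unfolding pls_subspace_def
  proof (intro conjI ballI impI)
    show "T \<subseteq> P" using U subspace_carrier[OF sU] line_subset unfolding T_def by auto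
    fix l q1 q2 assume h: "l \<in> L" "q1 \<in> T" "q2 \<in> T" "q1 \<noteq> q2 \<and> q1 \<in> l \<and> q2 \<in> l"
    show "l \<subseteq> T"
    proof
      fix x assume x: "x \<in> l"
      show "x \<in> T"
      proof (cases "q1 = p \<or> q2 = p \<or> x = q1 \<or> x = q2")
        case True then show ?thesis using pT h x by metis
      next
        case False
        obtain s1 l1 where s1: "s1 \<in> S" "l1 \<in> L" "p \<in> l1" "q1 \<in> l1" "s1 \<in> l1"
          using h False unfolding T_def by auto
        obtain s2 l2 where s2: "s2 \<in> S" "l2 \<in> L" "p \<in> l2" "q2 \<in> l2" "s2 \<in> l2"
          using h False unfolding T_def by auto
        show ?thesis
        proof (cases "l1 = l2")
          case True
          then have "l = l1" using line_unique[of l l1 q1 q2] h s1 s2 by auto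
          then show ?thesis using x s1 unfolding T_def by auto
        next
          case nl: False
          have "s1 \<noteq> s2" using nl line_unique[of l1 l2 p s1] s1 s2 U(5) by auto
          then show ?thesis
            using cone_aux[OF U s1(2-5) s1(1) s2(2,3) _ s2(5,1,4) h(1) _ _ x] h False nl
            unfolding T_def by auto
        qed
      qed
    qed
  qed
  moreover have "S \<subseteq> T"
  proof
    fix s assume s: "s \<in> S"
    then have "p \<noteq> s" "s \<in> U" using U by auto
    then obtain l where "l \<in> L" "p \<in> l" "s \<in> l" using sing_line[OF U(1,4)] by metis
    then show "s \<in> T" using s unfolding T_def by auto
  qed
  ultimately have "sp (insert p S) \<subseteq> T" by (intro span_least) (auto simp: T_def)
  then show ?thesis using q unfolding T_def by auto
qed

section \<open>Exchange property and rank\<close>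

lemma sing_carrier: "sing U \<Longrightarrow> U \<subseteq> P"
  unfolding singular_subspace_def using subspace_carrier by blast

lemma sp_insert_sp: "Z \<subseteq> P \<Longrightarrow> p \<in> P \<Longrightarrow> sp (insert p (sp Z)) = sp (insert p Z)"
proof (rule antisym)
  assume h: "Z \<subseteq> P" "p \<in> P"
  have "sp Z \<subseteq> sp (insert p Z)" by (intro span_mono) auto
  moreover have "p \<in> sp (insert p Z)" using in_sp by blast
  ultimately show "sp (insert p (sp Z)) \<subseteq> sp (insert p Z)"
    using h by (intro span_least sp_subsp) auto
  show "sp (insert p Z) \<subseteq> sp (insert p (sp Z))"
    using in_sp by (intro span_mono) blast
qed

text \<open>For \<open>q\<close> different from \<open>p\<close>, the line through them meets
  \<open>sp Z\<close> in a point \<open>s\<close>, which is not \<open>q\<close>. So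
  \<open>q\<close> and \<open>s\<close> span that line, and \<open>p\<close> is on it.\<close>

lemma sp_exchange:
  assumes U: "sing U" "Z \<subseteq> U" "p \<in> U" and q: "q \<in> sp (insert p Z)" "q \<notin> sp Z"
  shows "p \<in> sp (insert q Z)"
proof -
  have ZP: "Z \<subseteq> P" "p \<in> P" using U sing_carrier by auto
  have sZ: "sp Z \<subseteq> U" using U by (intro span_least) (auto simp: singular_subspace_def)
  have qU: "q \<in> U" using U q span_least[of P L U "insert p Z"] by (auto simp: singular_subspace_def)
  have "p \<notin> sp Z"
  proof
    assume "p \<in> sp Z"
    then have "sp (insert p Z) \<subseteq> sp Z"
      using span_superset[of Z] by (intro span_least sp_subsp ZP) auto
    then show False using q by auto
  qed
  show ?thesis
  proof (cases "q = p")
    case True then show ?thesis using in_sp by blast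
  next
    case False
    obtain s l where s: "s \<in> sp Z" "l \<in> L" "p \<in> l" "q \<in> l" "s \<in> l"
      using sp_insert_line[OF U(1) sZ sp_subsp[OF ZP(1)] U(3) \<open>p \<notin> sp Z\<close>, of q] q False
        sp_insert_sp[OF ZP] by auto
    have "insert q Z \<subseteq> P" using qU ZP sing_carrier U by auto
    then have sub: "subsp (sp (insert q Z))" by (rule sp_subsp)
    have "s \<in> sp (insert q Z)" using s span_mono[of Z "insert q Z"] by auto
    moreover have "q \<in> sp (insert q Z)" using in_sp by blast
    ultimately have "l \<subseteq> sp (insert q Z)"
      using subspace_line[OF sub s(2)] s q by blast
    then show ?thesis using s by auto
  qed
qed

text \<open>Add the elements of \<open>F\<close> to \<open>W\<close> one at a time: at some step
  \<open>i\<close> enters the span. Then \<open>t\<close> is the element just added and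
  \<open>W'\<close> is what was there before.\<close>

lemma span_witness:
  assumes "finite F" "i \<notin> sp W" "i \<in> sp (W \<union> F)" "W \<inter> F = {}"
  shows "\<exists>t\<in>F. \<exists>W'. W' \<subseteq> W \<union> F - {t} \<and> i \<notin> sp W' \<and> i \<in> sp (insert t W')"
  using assms
proof (induction F rule: finite_induct)
  case (insert t F)
  show ?case
  proof (cases "i \<in> sp (W \<union> F)")
    case True then show ?thesis using insert by blast
  next
    case False
    then show ?thesis using insert by (intro bexI[of _ t] exI[of _ "W \<union> F"]) auto
  qed
qed simp

text \<open>Each step trades an element of \<open>T - I\<close> for one of \<open>I - T\<close>,
  keeping the size of \<open>T\<close> and the inclusion of \<open>I\<close> in its span, until
  \<open>I \<subseteq> T\<close>.\<close>

lemma steinitz: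
  assumes U: "sing U" "T \<subseteq> U" "finite T" "finite I" "indep I" "I \<subseteq> sp T"
  shows "card I \<le> card T"
  using U(2,3,6)
proof (induction "card (I - T)" arbitrary: T)
  case 0
  then have "I \<subseteq> T" using U(4) by auto
  then show ?case using 0 by (simp add: card_mono)
next
  case (Suc r)
  have IU: "I \<subseteq> U" using Suc.prems U(1) span_least[of P L U T] by (auto simp: singular_subspace_def)
  obtain i where i: "i \<in> I" "i \<notin> T" using Suc.hyps(2) by (metis DiffE card.empty equals0I nat.distinct(1))
  \<comment> \<open>Starting \<open>span_witness\<close> from \<open>T \<inter> I\<close> ensures
    that the element traded away is not in \<open>I\<close>, so \<open>I - T\<close> really
    shrinks.\<close>
  have "i \<notin> sp (T \<inter> I)"
  proof
    assume "i \<in> sp (T \<inter> I)"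
    then have "i \<in> sp (I - {i})" using i span_mono[of "T \<inter> I" "I - {i}"] by blast
    then show False using U(5) i unfolding independent_iff by blast
  qed
  moreover have T: "(T \<inter> I) \<union> (T - I) = T" by blast
  moreover have "i \<in> sp T" using Suc.prems i by blast
  ultimately have "\<exists>t\<in>T - I. \<exists>W. W \<subseteq> (T \<inter> I) \<union> (T - I) - {t} \<and> i \<notin> sp W \<and> i \<in> sp (insert t W)"
    using Suc.prems(2) by (intro span_witness) auto
  then obtain t W where t: "t \<in> T - I" "W \<subseteq> T - {t}" "i \<notin> sp W" "i \<in> sp (insert t W)"
    unfolding T by blast
  let ?T = "insert i (T - {t})"
  have TU: "?T \<subseteq> U" using Suc.prems i IU by auto
  have "t \<in> sp (insert i W)" using sp_exchange[OF U(1)] t Suc.prems by blast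
  then have "t \<in> sp ?T" using span_mono[of "insert i W" ?T] t by blast
  then have "T \<subseteq> sp ?T" using span_superset[of ?T P L] by blast
  then have "sp T \<subseteq> sp ?T" using TU sing_carrier[OF U(1)] by (intro span_least sp_subsp) blast+
  then have IT: "I \<subseteq> sp ?T" using Suc.prems by auto
  have "I - T = insert i (I - ?T)" using i t by auto
  then have "card (I - T) = Suc (card (I - ?T))" using U(4) by simp
  then have "card I \<le> card ?T" using Suc.hyps TU IT Suc.prems by simp
  also have "\<dots> = card T" using i t Suc.prems
    by (metis DiffD1 card_Suc_Diff1 card_insert_disjoint finite_Diff)
  finally show ?case .
qed

lemma indep_insert:
  assumes U: "sing U" "I \<subseteq> U" "p \<in> U" and "indep I" "p \<notin> sp I"
  shows "indep (insert p I)"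
  unfolding independent_iff
proof (intro conjI ballI)
  show "insert p I \<subseteq> P" using U sing_carrier by auto
  fix z assume z: "z \<in> insert p I"
  show "z \<notin> sp (insert p I - {z})"
  proof (cases "z = p")
    case True
    then show ?thesis using assms(5) span_mono[of "insert p I - {p}" I] by auto
  next
    case False
    then have e: "insert p I - {z} = insert p (I - {z})" "insert z (I - {z}) = I" using z by auto
    have "z \<notin> sp (I - {z})" using z False assms(4) unfolding independent_iff by auto
    then show ?thesis
      using sp_exchange[OF U(1), of "I - {z}" p z] U e assms(5) by auto
  qed
qed

text \<open>Projective dimension plus one, as a natural number. It is meaningful for singular
  \<open>S\<close>, where \<open>indep_card_le\<close> bounds the set whose maximum is
  taken.\<close>

definition rk :: "'a set \<Rightarrow> nat" where
  "rk S = Max (card ` {I. I \<subseteq> S \<and> finite I \<and> indep I})"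

lemma indep_card_le:
  assumes "sing S" "I \<subseteq> S" "finite I" "indep I" shows "card I \<le> n"
proof -
  obtain M where M: "maximal_singular_subspace P L M" "S \<subseteq> M"
    using sing_in_maximal[OF assms(1)] .
  obtain B where B: "finite B" "indep B" "sp B = M" "int (card B) = int n - 1 + 1"
    using rank_dim[OF M(1)] unfolding pls_has_dim_def by blast
  have "card I \<le> card B"
    using M B assms span_superset[of B P L]
    by (intro steinitz[of M]) (auto simp: maximal_singular_subspace_def)
  then show ?thesis using B by simp
qed

lemma
  assumes "sing S"
  shows indep_card_le_rk: "I \<subseteq> S \<Longrightarrow> finite I \<Longrightarrow> indep I \<Longrightarrow> card I \<le> rk S"
    and rk_base: "\<exists>B. finite B \<and> indep B \<and> sp B = S \<and> card B = rk S"
    and rk_le: "rk S \<le> n"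
proof -
  let ?F = "card ` {I. I \<subseteq> S \<and> finite I \<and> indep I}"
  have sub: "?F \<subseteq> {..n}" using indep_card_le[OF assms] by auto
  then have fin: "finite ?F" by (rule finite_subset) simp
  have "indep {}" by (simp add: independent_iff)
  then have ne: "?F \<noteq> {}" by blast
  show le: "I \<subseteq> S \<Longrightarrow> finite I \<Longrightarrow> indep I \<Longrightarrow> card I \<le> rk S" for I
    unfolding rk_def using fin by (intro Max_ge) auto
  have "rk S \<in> ?F" unfolding rk_def using fin ne by (rule Max_in)
  then obtain B where B: "B \<subseteq> S" "finite B" "indep B" "card B = rk S" by auto
  show "rk S \<le> n" using B indep_card_le[OF assms] by metis
  have "sp B \<subseteq> S" using B assms by (intro span_least) (auto simp: singular_subspace_def)
  moreover have "p \<in> sp B" if "p \<in> S" for p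
  proof (rule ccontr)
    assume p: "p \<notin> sp B"
    then have "p \<notin> B" using in_sp by blast
    have "indep (insert p B)" using p that B by (intro indep_insert[OF assms])
    then have "card (insert p B) \<le> rk S" using that B by (intro le) auto
    then show False using B \<open>p \<notin> B\<close> by simp
  qed
  ultimately show "\<exists>B. finite B \<and> indep B \<and> sp B = S \<and> card B = rk S" using B by blast
qed

lemma rk_eq_card:
  assumes "sing S" "finite B" "indep B" "sp B = S" shows "rk S = card B"
proof (rule antisym)
  have BS: "B \<subseteq> S" using assms in_sp by blast
  obtain B' where B': "finite B'" "indep B'" "sp B' = S" "card B' = rk S"
    using rk_base[OF assms(1)] by blast
  then have "card B' \<le> card B" using BS assms span_superset[of B' P L] by (intro steinitz[of S]) auto
  then show "rk S \<le> card B" using B' by simp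
  show "card B \<le> rk S" using indep_card_le_rk[OF assms(1) BS] assms by simp
qed

lemma has_dim_iff: "sing S \<Longrightarrow> pls_has_dim P L S d \<longleftrightarrow> int (rk S) = d + 1"
  unfolding pls_has_dim_def using rk_base rk_eq_card by metis

text \<open>Mind the shift by one below: elements of the \<open>k\<close>-th Grassmannian have rank
  \<open>k + 1\<close>, the base of a star has rank \<open>k\<close>, the carrier of a top has rank
  \<open>k + 2\<close>.\<close>

lemma grassmannian_iff: "S \<in> polar_grassmannian P L j \<longleftrightarrow> sing S \<and> int (rk S) = j + 1"
  unfolding polar_grassmannian_def using has_dim_iff by auto

lemma rk_mono: "sing T \<Longrightarrow> sing S \<Longrightarrow> S \<subseteq> T \<Longrightarrow> rk S \<le> rk T"
  using rk_base[of S] indep_card_le_rk[of T] span_superset by (metis subset_trans)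

lemma rk_insert:
  assumes "sing U" "S \<subseteq> U" "subsp S" "p \<in> U" "p \<notin> S"
  shows "rk (sp (insert p S)) = rk S + 1" "sing (sp (insert p S))" "sp (insert p S) \<subseteq> U"
proof -
  show s: "sp (insert p S) \<subseteq> U" using assms by (intro span_least) (auto simp: singular_subspace_def)
  show sg: "sing (sp (insert p S))"
    using assms s sing_carrier by (intro singular_subset[OF assms(1)] sp_subsp) auto
  have sS: "sing S" using assms singular_subset by blast
  then obtain B where B: "finite B" "indep B" "sp B = S" "card B = rk S" using rk_base by blast
  have BU: "B \<subseteq> U" "B \<subseteq> S" using B in_sp assms by blast+
  have "indep (insert p B)" using assms B BU by (intro indep_insert[OF assms(1)]) auto
  moreover have "sp (insert p B) = sp (insert p S)"
    using sp_insert_sp[of B p] B(3) BU assms(4) sing_carrier[OF assms(1)] by (simp add: subset_iff)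
  ultimately have "rk (sp (insert p S)) = card (insert p B)" using sg B by (intro rk_eq_card) auto
  also have "\<dots> = rk S + 1" using B BU assms by (subst card_insert_disjoint) auto
  finally show "rk (sp (insert p S)) = rk S + 1" .
qed

lemma rk_eq_imp_eq:
  assumes "sing T" "sing S" "S \<subseteq> T" "rk T \<le> rk S" shows "S = T"
proof (rule ccontr)
  assume "S \<noteq> T"
  then obtain p where p: "p \<in> T" "p \<notin> S" using assms by blast
  note i = rk_insert[OF assms(1,3) singular_is_subspace[OF assms(2)] p]
  have "rk (sp (insert p S)) \<le> rk T" using rk_mono[OF assms(1) i(2,3)] .
  then show False using i assms by simp
qed

lemma sp_insert_eq:
  assumes "sing T" "sing S" "S \<subseteq> T" "p \<in> T" "p \<notin> S" "rk T = rk S + 1"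
  shows "sp (insert p S) = T"
proof -
  note i = rk_insert[OF assms(1,3) singular_is_subspace[OF assms(2)] assms(4,5)]
  show ?thesis using rk_eq_imp_eq[OF assms(1) i(2,3)] i assms by simp
qed

text \<open>\<open>U\<close> is the cone over \<open>H\<close> with vertex \<open>p\<close>, so the
  line from \<open>p\<close> to any other point of \<open>W\<close> meets \<open>H\<close>; it also
  stays inside \<open>W\<close>. Thus \<open>W\<close> is the cone over
  \<open>W \<inter> H\<close>.\<close>

lemma hyperplane_Int:
  assumes U: "sing U" "sing H" "H \<subseteq> U" "rk U = rk H + 1" and W: "subsp W" "W \<subseteq> U"
    and p: "p \<in> W" "p \<notin> H"
  shows "W = sp (insert p (W \<inter> H))" "rk W = rk (W \<inter> H) + 1"
proof -
  have UH: "sp (insert p H) = U" using assms by (intro sp_insert_eq) auto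
  have sH: "subsp H" using U by (simp add: singular_subspace_def)
  have WP: "W \<subseteq> P" using W subspace_carrier by blast
  have sWH: "subsp (W \<inter> H)" using W(1) sH by (rule subspace_Int)
  have sub: "subsp (sp (insert p (W \<inter> H)))" using p WP by (intro sp_subsp) auto
  have pin: "p \<in> sp (insert p (W \<inter> H))" using in_sp by blast
  have "q \<in> sp (insert p (W \<inter> H))" if q: "q \<in> W" for q
  proof (cases "q = p")
    case False
    obtain h l where h: "h \<in> H" "l \<in> L" "p \<in> l" "q \<in> l" "h \<in> l"
      using sp_insert_line[OF U(1,3) sH, of p q] UH False p q W by blast
    then have "l \<subseteq> W" using subspace_line[OF W(1) h(2)] p q False by blast
    then have "h \<in> insert p (W \<inter> H)" using h by auto
    then have hin: "h \<in> sp (insert p (W \<inter> H))" by (rule in_sp)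
    have "h \<noteq> p" using h p by auto
    then have "l \<subseteq> sp (insert p (W \<inter> H))" by (rule subspace_line[OF sub h(2) hin pin _ h(5,3)])
    then show ?thesis using h by auto
  qed (use pin in simp)
  moreover have "sp (insert p (W \<inter> H)) \<subseteq> W" using W p by (intro span_least) auto
  ultimately show e: "W = sp (insert p (W \<inter> H))" by blast
  have "rk (sp (insert p (W \<inter> H))) = rk (W \<inter> H) + 1"
    using W p by (intro rk_insert(1)[OF U(1) _ sWH]) auto
  then show "rk W = rk (W \<inter> H) + 1" by (simp only: e[symmetric])
qed

end

section \<open>Cliques of singular subspaces\<close>

context polar_space
begin

abbreviation gsub :: "nat \<Rightarrow> 'a set set \<Rightarrow> bool" where
  "gsub k \<equiv> pls_subspace (polar_grassmannian P L (int k)) (grass_lines P L (int k))"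
abbreviation gspan :: "nat \<Rightarrow> 'a set set \<Rightarrow> 'a set set" where
  "gspan k \<equiv> pls_span (polar_grassmannian P L (int k)) (grass_lines P L (int k))"
abbreviation adj :: "nat \<Rightarrow> 'a set \<Rightarrow> 'a set \<Rightarrow> bool" where
  "adj k \<equiv> grass_adj P L (int k)"

section \<open>Adjacent pairs, triples and quadruples\<close>

lemma gsub_line:
  assumes W: "gsub k W" and "sing S" "rk S = k" "sing U" "rk U = k + 2"
    and X: "X \<in> W" "S \<subseteq> X" "X \<subseteq> U" and Y: "Y \<in> W" "S \<subseteq> Y" "Y \<subseteq> U" "X \<noteq> Y"
    and Z: "sing Z" "rk Z = k + 1" "S \<subseteq> Z" "Z \<subseteq> U"
  shows "Z \<in> W"
proof -
  let ?l = "grass_interval P L (int k) S U"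
  have "S \<subseteq> U" using X by auto
  then have l: "?l \<in> grass_lines P L (int k)"
    using assms(2-5) unfolding grass_lines_def
    by (intro CollectI exI[of _ S] exI[of _ U]) (simp add: grassmannian_iff)
  have "X \<in> ?l" "Y \<in> ?l"
    using X Y subspace_carrier[OF W] unfolding grass_interval_def by auto
  moreover have "Z \<in> ?l" using Z unfolding grass_interval_def by (simp add: grassmannian_iff)
  ultimately show ?thesis using subspace_line[OF W l X(1) Y(1,4)] by auto
qed

lemma adj_iff:
  "adj k X Y \<longleftrightarrow> sing X \<and> sing Y \<and> rk X = k + 1 \<and> rk Y = k + 1 \<and> rk (X \<inter> Y) = k \<and>
     (\<forall>p\<in>X. \<forall>q\<in>Y. col p q)"
  unfolding grass_adj_def grassmannian_iff
  using has_dim_iff[of "X \<inter> Y" "int k - 1"] singular_Int[of P L X Y] singular_is_subspace[of P L Y]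
  by auto

lemma adj_neq:
  assumes "adj k X Y" shows "X \<noteq> Y"
proof
  assume "X = Y"
  then have "rk (X \<inter> Y) = rk X" by simp
  moreover have "rk (X \<inter> Y) = k" "rk X = k + 1" using assms unfolding adj_iff by blast+
  ultimately show False by simp
qed

lemma sing_Int2: "sing X \<Longrightarrow> sing Y \<Longrightarrow> sing (X \<inter> Y)"
  by (simp add: singular_Int singular_is_subspace)

lemma adj_not_subset:
  assumes "adj k X Y" shows "\<exists>p. p \<in> Y \<and> p \<notin> X"
proof (rule ccontr)
  assume "\<not> ?thesis"
  then have "X \<inter> Y = Y" by auto
  moreover have "rk (X \<inter> Y) = k" "rk Y = k + 1" using assms unfolding adj_iff by blast+
  ultimately show False by simp
qed

text \<open>A point \<open>p\<close> of \<open>Y\<close> outside \<open>X\<close> spans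
  \<open>Y\<close> together with \<open>X \<inter> Y\<close>, so the join is already spanned by
  \<open>p\<close> and \<open>X\<close>.\<close>

lemma adj_join:
  assumes "adj k X Y"
  shows "sing (sp (X \<union> Y))" "rk (sp (X \<union> Y)) = k + 2"
proof -
  note a = assms[unfolded adj_iff]
  have c: "col p q" if "p \<in> X \<union> Y" "q \<in> X \<union> Y" for p q
    using a that unfolding singular_subspace_def by (metis Un_iff collinear_sym)
  show s: "sing (sp (X \<union> Y))" using a sing_carrier c by (intro sp_sing) auto
  obtain p where p: "p \<in> Y" "p \<notin> X" using adj_not_subset[OF assms] by blast
  have Y: "sp (insert p (X \<inter> Y)) = Y" using a p sing_Int2 by (intro sp_insert_eq) auto
  have XU: "X \<subseteq> sp (X \<union> Y)" "p \<in> sp (X \<union> Y)" using in_sp[of _ "X \<union> Y"] p by auto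
  have Xs: "subsp X" using a by (simp add: singular_is_subspace)
  note i = rk_insert[OF s XU(1) Xs XU(2) p(2)]
  have "Y \<subseteq> sp (insert p X)" using Y span_mono[of "insert p (X \<inter> Y)" "insert p X" P L] by auto
  moreover have "X \<subseteq> sp (insert p X)" using in_sp[of _ "insert p X"] by auto
  ultimately have "sp (X \<union> Y) \<subseteq> sp (insert p X)"
    using i(2) by (intro span_least singular_is_subspace) auto
  then show "rk (sp (X \<union> Y)) = k + 2" using i a by (simp add: antisym)
qed

lemma sub_join: "X \<subseteq> sp (X \<union> Y)" "Y \<subseteq> sp (X \<union> Y)"
  using in_sp[of _ "X \<union> Y"] by auto

lemma adj_in:
  assumes U: "sing U" "rk U = k + 2" and X: "sing X" "rk X = k + 1" "X \<subseteq> U"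
    and Y: "sing Y" "rk Y = k + 1" "Y \<subseteq> U" and "X \<noteq> Y"
  shows "adj k X Y"
proof -
  obtain p where p: "p \<in> X" "p \<notin> Y" using rk_eq_imp_eq[of Y X] X Y \<open>X \<noteq> Y\<close> by auto
  have "rk X = rk (X \<inter> Y) + 1"
    using hyperplane_Int(2)[OF U(1) Y(1,3) _ singular_is_subspace[OF X(1)] X(3) p] U Y by simp
  moreover have "\<forall>p\<in>X. \<forall>q\<in>Y. col p q" using U(1) X Y unfolding singular_subspace_def by blast
  ultimately show ?thesis using X Y unfolding adj_iff by simp
qed

lemma adj_Int_eq:
  assumes "adj k X Y" "adj k X' Y'" "X \<inter> Y \<subseteq> X' \<inter> Y'" shows "X \<inter> Y = X' \<inter> Y'"
  using assms rk_eq_imp_eq[of "X' \<inter> Y'" "X \<inter> Y"] sing_Int2 unfolding adj_iff by auto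

text \<open>All pairwise intersections have rank \<open>k\<close>, so if \<open>Z\<close> misses
  part of \<open>X \<inter> Y\<close>, then \<open>X \<inter> Z\<close> has a point outside
  \<open>Y\<close>. That point and \<open>Y \<inter> Z\<close> span \<open>Z\<close>, and both lie
  in \<open>X \<union> Y\<close>.\<close>

lemma adj_triple:
  assumes XY: "adj k X Y" and XZ: "adj k X Z" and YZ: "adj k Y Z" and n: "\<not> X \<inter> Y \<subseteq> Z"
  shows "Z \<subseteq> sp (X \<union> Y)"
proof -
  have "\<not> X \<inter> Z \<subseteq> Y"
  proof
    assume "X \<inter> Z \<subseteq> Y"
    then have "X \<inter> Z = X \<inter> Y" by (intro adj_Int_eq[OF XZ XY]) auto
    then show False using n by auto
  qed
  then obtain p where p: "p \<in> X" "p \<in> Z" "p \<notin> Y" by auto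
  have "sp (insert p (Y \<inter> Z)) = Z"
    using YZ p sing_Int2 unfolding adj_iff by (intro sp_insert_eq) auto
  moreover have "sp (insert p (Y \<inter> Z)) \<subseteq> sp (X \<union> Y)" using p by (intro span_mono) auto
  ultimately show ?thesis by simp
qed

text \<open>As \<open>Z\<close> sticks out of the join of \<open>X\<close> and \<open>Y\<close>, it
  meets that join in rank at most \<open>k\<close>. Both \<open>X \<inter> Y\<close> and
  \<open>Z \<inter> V\<close> have rank \<open>k\<close> and lie in this intersection, so they
  coincide.\<close>

lemma adj_four:
  assumes XY: "adj k X Y" and XZ: "adj k X Z" and ZV: "adj k Z V"
    and Z: "X \<inter> Y \<subseteq> Z" "\<not> Z \<subseteq> sp (X \<union> Y)" and V: "V \<subseteq> sp (X \<union> Y)"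
  shows "X \<inter> Y \<subseteq> V"
proof -
  let ?I = "sp (X \<union> Y) \<inter> Z"
  have sI: "sing ?I" using adj_join(1)[OF XY] XZ sing_Int2 unfolding adj_iff by auto
  have "\<not> rk Z \<le> rk ?I" using rk_eq_imp_eq[of Z ?I] sI Z(2) XZ unfolding adj_iff by auto
  then have r: "rk ?I \<le> k" using XZ unfolding adj_iff by simp
  have "X \<inter> Y \<subseteq> ?I" using Z(1) sub_join by auto
  then have "X \<inter> Y = ?I" using XY r sI sing_Int2 unfolding adj_iff by (intro rk_eq_imp_eq) auto
  moreover have "Z \<inter> V = ?I"
    using ZV r V sI sing_Int2 unfolding adj_iff by (intro rk_eq_imp_eq) auto
  ultimately show ?thesis by auto
qed

section \<open>Independent families in stars and in tops\<close>

lemma sp_insert_star: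
  assumes U: "sing U" "S \<subseteq> U" "\<Union>\<D> \<subseteq> U" "x \<in> U" "X = sp (insert x S)"
  shows "sp (S \<union> \<Union>(insert X \<D>)) = sp (insert x (sp (S \<union> \<Union>\<D>)))"
proof (rule antisym)
  have UP: "U \<subseteq> P" using U(1) by (rule sing_carrier)
  have XU: "X \<subseteq> U" unfolding U(5) using U(1,2,4) by (intro span_least singular_is_subspace) auto
  have spU: "sp (S \<union> \<Union>\<D>) \<subseteq> U" using U by (intro span_least singular_is_subspace) auto
  have "X \<subseteq> sp (insert x (sp (S \<union> \<Union>\<D>)))"
    unfolding U(5) using in_sp[of _ "S \<union> \<Union>\<D>"] by (intro span_mono) auto
  moreover have "S \<union> \<Union>\<D> \<subseteq> sp (insert x (sp (S \<union> \<Union>\<D>)))"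
    using in_sp[of _ "insert x (sp (S \<union> \<Union>\<D>))"] in_sp[of _ "S \<union> \<Union>\<D>"] by blast
  ultimately show "sp (S \<union> \<Union>(insert X \<D>)) \<subseteq> sp (insert x (sp (S \<union> \<Union>\<D>)))"
    using UP U(4) spU by (intro span_least sp_subsp) auto
  have "x \<in> X" unfolding U(5) by (rule in_sp) simp
  then have "x \<in> sp (S \<union> \<Union>(insert X \<D>))" by (intro in_sp) auto
  moreover have "sp (S \<union> \<Union>\<D>) \<subseteq> sp (S \<union> \<Union>(insert X \<D>))" by (intro span_mono) auto
  ultimately show "sp (insert x (sp (S \<union> \<Union>\<D>))) \<subseteq> sp (S \<union> \<Union>(insert X \<D>))"
    using UP U(2,3) XU by (intro span_least sp_subsp) auto
qed

text \<open>The members of a star inside \<open>U\<close> are the points of the quotient projective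
  space \<open>U / S\<close>, and Grassmann lines are its lines. The proof follows the cone
  description there: \<open>Y\<close> lies on the line joining the new member \<open>X\<close> to a
  member inside the old join.\<close>

lemma star_span:
  assumes "finite \<D>" and U: "sing U" and S: "sing S" "rk S = k" "S \<subseteq> U"
    and \<D>: "\<And>X. X \<in> \<D> \<Longrightarrow> sing X \<and> rk X = k + 1 \<and> S \<subseteq> X \<and> X \<subseteq> U"
    and W: "gsub k W" "\<D> \<subseteq> W"
    and Y: "sing Y" "rk Y = k + 1" "S \<subseteq> Y" "Y \<subseteq> sp (S \<union> \<Union>\<D>)"
  shows "Y \<in> W"
  using assms(1) \<D> W(2) Y
proof (induction \<D> arbitrary: Y rule: finite_induct)
  case empty
  have "sp S = S" using S by (intro span_of_subspace singular_is_subspace)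
  then have "Y = S" using empty by auto
  then show ?case using empty S by simp
next
  case (insert X \<D>)
  let ?T = "sp (S \<union> \<Union>\<D>)"
  have X: "sing X" "rk X = k + 1" "S \<subseteq> X" "X \<subseteq> U" "X \<in> W" using insert.prems by auto
  have DU: "\<Union>\<D> \<subseteq> U" using insert.prems(1) by blast
  have TU: "?T \<subseteq> U" using DU S U by (intro span_least singular_is_subspace) auto
  have sT: "subsp ?T" using DU S sing_carrier[OF U] by (intro sp_subsp) auto
  have ST: "S \<subseteq> ?T" using in_sp[of _ "S \<union> \<Union>\<D>"] by auto
  have IH: "Z \<in> W" if "sing Z" "rk Z = k + 1" "S \<subseteq> Z" "Z \<subseteq> ?T" for Z
    using insert.IH[OF _ _ that] insert.prems by auto
  obtain x where x: "x \<in> X" "x \<notin> S" using rk_eq_imp_eq[of S X] X S by fastforce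
  have Xx: "X = sp (insert x S)" using sp_insert_eq[of X S x] X S x by simp
  note T' = sp_insert_star[OF U S(3) DU _ Xx]
  obtain y where y: "y \<in> Y" "y \<notin> S" using rk_eq_imp_eq[of S Y] insert.prems S by fastforce
  have Yy: "Y = sp (insert y S)" using sp_insert_eq[of Y S y] insert.prems S y by simp
  have xU: "x \<in> U" using x X by auto
  have yT: "y \<in> sp (insert x ?T)" using T' xU y insert.prems by auto
  have YX: "Y = X" if "y \<in> X"
  proof -
    have "Y \<subseteq> X" unfolding Yy using that X by (intro span_least singular_is_subspace) auto
    then show ?thesis using insert.prems X by (intro rk_eq_imp_eq) auto
  qed
  show ?case
  proof (cases "x \<in> ?T \<or> y \<in> ?T")
    case True
    have "y \<in> ?T"
    proof (cases "x \<in> ?T")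
      case True
      then have "sp (insert x ?T) = ?T" using span_of_subspace[OF sT] by (simp add: insert_absorb)
      then show ?thesis using yT by simp
    qed (use True in simp)
    then have "Y \<subseteq> ?T" unfolding Yy using ST sT by (intro span_least) auto
    then show ?thesis using IH insert.prems by auto
  next
    case F: False
    show ?thesis
    proof (cases "y = x")
      case True then show ?thesis using YX x X by simp
    next
      case False
      obtain t l where t: "t \<in> ?T" "l \<in> L" "x \<in> l" "y \<in> l" "t \<in> l"
        using sp_insert_line[OF U TU sT xU] F yT False by blast
      have xt: "x \<noteq> t" using t F by auto
      show ?thesis
      proof (cases "t \<in> S")
        case True
        then have "l \<subseteq> X"
          using subspace_line[OF singular_is_subspace[OF X(1)] t(2) x(1) _ xt t(3,5)] X by auto
        then show ?thesis using YX t X by auto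
      next
        case ts: False
        let ?Z = "sp (insert t S)"
        have tU: "t \<in> U" using t TU by auto
        note Z = rk_insert[OF U S(3) singular_is_subspace[OF S(1)] tU ts]
        have SZ: "S \<subseteq> ?Z" "t \<in> ?Z" using in_sp[of _ "insert t S"] by auto
        have ZT: "?Z \<subseteq> ?T" using ST t sT by (intro span_least) auto
        have ZW: "?Z \<in> W" using IH[OF Z(2) _ SZ(1) ZT] Z S by simp
        have xZ: "x \<notin> ?Z" using ZT F by auto
        note V = rk_insert[OF U Z(3) singular_is_subspace[OF Z(2)] xU xZ]
        \<comment> \<open>\<open>X\<close>, \<open>Y\<close> and \<open>?Z\<close> all lie between
          \<open>S\<close> and \<open>?V\<close>, whose rank is \<open>k + 2\<close>, hence on one
          Grassmann line; \<open>X\<close> and \<open>?Z\<close> are already in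
          \<open>W\<close>.\<close>
        let ?V = "sp (insert x ?Z)"
        have V1: "?Z \<subseteq> ?V" "x \<in> ?V" using in_sp[of _ "insert x ?Z"] by auto
        have XV: "X \<subseteq> ?V" unfolding Xx using SZ by (intro span_mono) auto
        have "l \<subseteq> ?V"
          using subspace_line[OF singular_is_subspace[OF V(2)] t(2) V1(2) _ xt t(3,5)] V1 SZ by auto
        then have "insert y S \<subseteq> ?V" using t V1 SZ by auto
        then have YV: "Y \<subseteq> ?V" unfolding Yy by (intro span_least singular_is_subspace V(2))
        have "X \<noteq> ?Z" using xZ x by auto
        then show ?thesis
          using gsub_line[OF W(1) S(1,2) V(2) _ X(5,3) XV ZW SZ(1) V1(1)] YV V Z S insert.prems
          by simp
      qed
    qed
  qed
qed

text \<open>By \<open>star_span\<close>, independence forces each member to stick out of the join of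
  the others considered so far. The joins therefore have ranks \<open>k\<close>,
  \<open>k + 1\<close> and so on, and \<open>n\<close> bounds the last one.\<close>

lemma star_card_le:
  assumes fin: "finite \<C>" and U: "sing U" and S: "sing S" "rk S = k" "S \<subseteq> U"
    and \<C>: "\<And>X. X \<in> \<C> \<Longrightarrow> sing X \<and> rk X = k + 1 \<and> S \<subseteq> X \<and> X \<subseteq> U"
    and ind: "\<And>X. X \<in> \<C> \<Longrightarrow> X \<notin> gspan k (\<C> - {X})"
  shows "k + card \<C> \<le> n"
proof -
  have "sing (sp (S \<union> \<Union>\<D>)) \<and> rk (sp (S \<union> \<Union>\<D>)) = k + card \<D>" if "\<D> \<subseteq> \<C>" for \<D>
    using finite_subset[OF that fin] that
  proof (induction \<D> rule: finite_induct)
    case empty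
    have "sp S = S" using S by (intro span_of_subspace singular_is_subspace)
    then show ?case using S by simp
  next
    case (insert X \<D>)
    let ?T = "sp (S \<union> \<Union>\<D>)"
    have X: "sing X" "rk X = k + 1" "S \<subseteq> X" "X \<subseteq> U" using insert.prems \<C> by auto
    have DU: "\<Union>\<D> \<subseteq> U" using insert.prems \<C> by auto
    have TU: "?T \<subseteq> U" using DU S U by (intro span_least singular_is_subspace) auto
    have T: "sing ?T" "rk ?T = k + card \<D>" using insert by auto
    have "\<not> X \<subseteq> ?T"
    proof
      assume XT: "X \<subseteq> ?T"
      have "X \<in> gspan k (\<C> - {X})"
        unfolding pls_span_def
      proof (rule InterI)
        fix W assume "W \<in> {W. gsub k W \<and> \<C> - {X} \<subseteq> W}"
        then have W: "gsub k W" "\<D> \<subseteq> W" using insert by auto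
        show "X \<in> W"
          by (rule star_span[OF insert.hyps(1) U S _ W X(1-3) XT]) (use \<C> insert.prems in auto)
      qed
      then show False using ind insert.prems by auto
    qed
    then obtain x where x: "x \<in> X" "x \<notin> ?T" by auto
    have "x \<notin> S" using x in_sp[of _ "S \<union> \<Union>\<D>"] by auto
    then have Xx: "X = sp (insert x S)" using sp_insert_eq[of X S x] X S x by simp
    have xU: "x \<in> U" using x X by auto
    show ?case
      using rk_insert[OF U TU singular_is_subspace[OF T(1)] xU x(2)] T insert.hyps
      unfolding sp_insert_star[OF U S(3) DU xU Xx] by simp
  qed
  then show ?thesis using rk_le by (metis order_refl)
qed

text \<open>Dual of \<open>star_span\<close>: hyperplanes of \<open>U\<close> are the points of the
  dual projective space, so intersections replace joins. Meeting with \<open>U\<close> gives the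
  empty family the value \<open>U\<close> instead of the universe.\<close>

lemma top_span:
  assumes "finite \<D>" and U: "sing U" "rk U = k + 2"
    and \<D>: "\<And>X. X \<in> \<D> \<Longrightarrow> sing X \<and> rk X = k + 1 \<and> X \<subseteq> U"
    and W: "gsub k W" "\<D> \<subseteq> W"
    and Y: "sing Y" "rk Y = k + 1" "Y \<subseteq> U" "U \<inter> \<Inter>\<D> \<subseteq> Y"
  shows "Y \<in> W"
  using assms(1) \<D> W(2) Y
proof (induction \<D> arbitrary: Y rule: finite_induct)
  case empty
  then have "Y = U" by auto
  then show ?case using empty U by simp
next
  case (insert H \<D>)
  let ?V = "U \<inter> \<Inter>\<D>"
  have H: "sing H" "rk H = k + 1" "H \<subseteq> U" "H \<in> W" using insert.prems by auto
  have IH: "Z \<in> W" if "sing Z" "rk Z = k + 1" "Z \<subseteq> U" "?V \<subseteq> Z" for Z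
    using insert.IH[OF _ _ that] insert.prems by auto
  have VH: "?V \<inter> H \<subseteq> Y" using insert.prems by auto
  have YU: "sing Y" "rk Y = k + 1" "Y \<subseteq> U" using insert.prems by auto
  show ?case
  proof (cases "?V \<subseteq> Y \<or> Y = H")
    case True then show ?thesis using IH[OF YU] H by auto
  next
    case F: False
    have "?V = \<Inter>(insert U \<D>)" by auto
    moreover have "subsp (\<Inter>(insert U \<D>))"
      using U insert.prems by (intro subspace_Inter) (auto simp: singular_subspace_def)
    ultimately have sV: "subsp ?V" by simp
    obtain p where p: "p \<in> ?V" "p \<notin> H" using F VH by auto
    note V = hyperplane_Int(1)[OF U(1) H(1,3) _ sV _ p]
    let ?S = "Y \<inter> H"
    have "adj k Y H" using adj_in[OF U YU H(1,2,3)] F by simp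
    then have S: "rk ?S = k" "sing ?S" using sing_Int2 unfolding adj_iff by auto
    have pS: "p \<notin> ?S" "p \<in> U" "?S \<subseteq> U" using p H by auto
    \<comment> \<open>The hyperplane spanned by \<open>p\<close> and \<open>?S\<close> contains
      \<open>?V\<close>, so the induction hypothesis puts it in \<open>W\<close>. It shares a
      Grassmann line with \<open>H\<close> and \<open>Y\<close>, since all three lie between
      \<open>?S\<close> and \<open>U\<close>.\<close>
    note Z = rk_insert[OF U(1) pS(3) singular_is_subspace[OF S(2)] pS(2,1)]
    have Z1: "?S \<subseteq> sp (insert p ?S)" "p \<in> sp (insert p ?S)" using in_sp[of _ "insert p ?S"] by auto
    have "sp (insert p (?V \<inter> H)) \<subseteq> sp (insert p ?S)" using VH by (intro span_mono) auto
    then have "?V \<subseteq> sp (insert p ?S)" using V U H by auto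
    then have ZW: "sp (insert p ?S) \<in> W" using IH Z S by simp
    have "sp (insert p ?S) \<noteq> H" using Z1 p by auto
    then show ?thesis
      using gsub_line[OF W(1) S(2,1) U ZW Z1(1) Z(3) H(4) _ H(3) _ YU(1,2) _ YU(3)] by simp
  qed
qed

text \<open>By \<open>top_span\<close>, no member contains the intersection of others in the family,
  so each one cuts the rank by exactly one. Subfamilies \<open>\<D>\<close> are allowed because the
  later subspaces are intersections of only some hyperplanes of a clique.\<close>

lemma top_rank:
  assumes fin: "finite \<C>" and U: "sing U" "rk U = k + 2"
    and \<C>: "\<And>X. X \<in> \<C> \<Longrightarrow> sing X \<and> rk X = k + 1 \<and> X \<subseteq> U"
    and ind: "\<And>X. X \<in> \<C> \<Longrightarrow> X \<notin> gspan k (\<C> - {X})"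
    and "\<D> \<subseteq> \<C>"
  shows "sing (U \<inter> \<Inter>\<D>) \<and> rk (U \<inter> \<Inter>\<D>) + card \<D> = k + 2"
  using finite_subset[OF \<open>\<D> \<subseteq> \<C>\<close> fin] \<open>\<D> \<subseteq> \<C>\<close>
proof (induction \<D> rule: finite_induct)
  case empty
  then show ?case using U by simp
next
  case (insert H \<D>)
  let ?V = "U \<inter> \<Inter>\<D>"
  have H: "sing H" "rk H = k + 1" "H \<subseteq> U" using insert.prems \<C> by auto
  have V: "sing ?V" "rk ?V + card \<D> = k + 2" using insert by auto
  have "\<not> ?V \<subseteq> H"
  proof
    assume VH: "?V \<subseteq> H"
    have "H \<in> gspan k (\<C> - {H})"
      unfolding pls_span_def
    proof (rule InterI)
      fix W assume "W \<in> {W. gsub k W \<and> \<C> - {H} \<subseteq> W}"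
      then have W: "gsub k W" "\<D> \<subseteq> W" using insert by auto
      show "H \<in> W"
        by (rule top_span[OF insert.hyps(1) U _ W H VH]) (use \<C> insert.prems in auto)
    qed
    then show False using ind insert.prems by auto
  qed
  then obtain p where p: "p \<in> ?V" "p \<notin> H" by auto
  have "rk ?V = rk (?V \<inter> H) + 1"
    using hyperplane_Int(2)[OF U(1) H(1,3) _ singular_is_subspace[OF V(1)] _ p] U H by simp
  moreover have "?V \<inter> H = U \<inter> \<Inter>(insert H \<D>)" by auto
  moreover have "sing (?V \<inter> H)" using V H sing_Int2 by blast
  ultimately show ?case using V insert.hyps by simp
qed

end

section \<open>The polar Johnson graph\<close>

lemma PJ_subset: "PJ_singular l B \<Longrightarrow> A \<subseteq> B \<Longrightarrow> PJ_singular l A"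
  unfolding PJ_singular_def by blast

lemma PJ_bounds: "PJ_singular l A \<Longrightarrow> A \<subseteq> {- int l..int l}"
proof -
  have "{j. 1 \<le> \<bar>j\<bar> \<and> \<bar>j\<bar> \<le> int l} \<subseteq> {- int l..int l}" by auto
  then show "PJ_singular l A \<Longrightarrow> ?thesis" unfolding PJ_singular_def by blast
qed

lemma PJ_finite: "PJ_singular l A \<Longrightarrow> finite A"
  using PJ_bounds finite_subset by blast

lemma PJ_insert:
  "PJ_singular l A \<Longrightarrow> 1 \<le> \<bar>x\<bar> \<Longrightarrow> \<bar>x\<bar> \<le> int l \<Longrightarrow> - x \<notin> A \<Longrightarrow> PJ_singular l (insert x A)"
  unfolding PJ_singular_def by (auto simp: minus_equation_iff[of _ x])

lemma PJ_flip:
  "PJ_singular l (insert (x::int) A) \<Longrightarrow> x \<notin> A \<Longrightarrow> PJ_singular l (insert (- x) A)"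
  by (rule PJ_insert) (auto simp: PJ_singular_def)

lemma PJ_not_both: "PJ_singular l A \<Longrightarrow> x \<in> A \<Longrightarrow> - x \<notin> A"
  unfolding PJ_singular_def by blast

lemma PJ_new:
  assumes "PJ_singular l A" "card A < l"
  obtains x where "x \<notin> A" "- x \<notin> A" "PJ_singular l (insert x A)"
proof -
  have fin: "finite A" using assms(1) by (rule PJ_finite)
  have "card (abs ` A) < card {1..int l}" using card_image_le[OF fin, of abs] assms(2) by simp
  then have "\<not> {1..int l} \<subseteq> abs ` A" using fin by (meson card_mono finite_imageI leD)
  then obtain x where x: "x \<in> {1..int l}" "x \<notin> abs ` A" by blast
  then have "x \<notin> A" "- x \<notin> A" by (auto simp: image_iff)
  then show thesis using x by (intro that PJ_insert assms(1)) auto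
qed

lemma PJ_extend:
  assumes "PJ_singular l A" "card A \<le> s" "s \<le> l"
  obtains B where "A \<subseteq> B" "PJ_singular l B" "card B = s"
proof -
  have "\<exists>B. A \<subseteq> B \<and> PJ_singular l B \<and> card B = s"
    using assms(2,3)
  proof (induction s rule: dec_induct)
    case base
    then show ?case using assms(1) by auto
  next
    case (step s)
    then obtain B where B: "A \<subseteq> B" "PJ_singular l B" "card B = s" by auto
    moreover have "card B < l" using B(3) step by simp
    then obtain x where "x \<notin> B" "PJ_singular l (insert x B)" using PJ_new[OF B(2)] by blast
    ultimately show ?case using PJ_finite[OF B(2)] by (intro exI[of _ "insert x B"]) auto
  qed
  then show thesis using that by blast
qed

text \<open>Singular sets of equal size over \<open>C\<close> are connected by single exchanges. To
  bring in \<open>x\<close> from \<open>B'\<close>, remove \<open>- x\<close> if it is present and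
  otherwise any element of \<open>B - B'\<close>; since \<open>B'\<close> is singular,
  \<open>- x\<close> is not in \<open>B'\<close>, so the distance to \<open>B'\<close> drops either
  way.\<close>

lemma PJ_exchange_induct:
  assumes "PJ_singular l B" "PJ_singular l B'" "card B = card B'" "C \<subseteq> B" "C \<subseteq> B'" "Q B"
    and step: "\<And>B x y. \<lbrakk>PJ_singular l B; C \<subseteq> B; card B = card B'; x \<notin> B; y \<in> B; y \<notin> C;
      PJ_singular l (insert x (B - {y})); Q B\<rbrakk> \<Longrightarrow> Q (insert x (B - {y}))"
  shows "Q B'"
  using assms(1,3,4,6)
proof (induction "card (B - B')" arbitrary: B)
  case 0
  then have "B \<subseteq> B'" using PJ_finite[of l B] by auto
  then have "B = B'" using 0 PJ_finite[OF assms(2)] by (intro card_subset_eq) auto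
  then show ?case using 0 by simp
next
  case (Suc r)
  have fin: "finite B" "finite B'" using PJ_finite Suc.prems(1) assms(2) by blast+
  have "\<not> B' \<subseteq> B"
  proof
    assume "B' \<subseteq> B"
    then have "B' = B" using card_subset_eq[OF fin(1)] Suc.prems(2) by simp
    then show False using Suc.hyps(2) by simp
  qed
  then obtain x where x: "x \<in> B'" "x \<notin> B" by blast
  have xl: "1 \<le> \<bar>x\<bar>" "\<bar>x\<bar> \<le> int l" using assms(2) x unfolding PJ_singular_def by blast+
  obtain y where y: "y \<in> B" "y \<notin> B'" "- x \<notin> B - {y}"
  proof (cases "- x \<in> B")
    case True
    then show thesis using that[of "- x"] PJ_not_both[OF assms(2) x(1)] by auto
  next
    case False
    have "B - B' \<noteq> {}" using Suc.hyps(2) by (metis card.empty nat.distinct(1))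
    then show thesis using that False by blast
  qed
  let ?B = "insert x (B - {y})"
  have B: "PJ_singular l ?B"
    using y xl by (intro PJ_insert PJ_subset[OF Suc.prems(1)]) auto
  have "B - B' = insert y (?B - B')" "y \<notin> ?B - B'" using x y by auto
  then have "r = card (?B - B')" using Suc.hyps(2) fin by simp
  moreover have "card ?B = card B'"
    using x y fin Suc.prems by (metis DiffD1 card_Suc_Diff1 card_insert_disjoint finite_Diff)
  moreover have "C \<subseteq> ?B" using Suc.prems y assms(5) by auto
  moreover have "Q ?B" using step[of B x y] Suc.prems x y B assms(5) by auto
  ultimately show ?case using Suc.hyps(1)[of ?B] B by blast
qed

lemma PJ_verts_finite: "finite (PJ_verts l m)"
proof (rule finite_subset)
  show "PJ_verts l m \<subseteq> Pow {- int l..int l}" using PJ_bounds unfolding PJ_verts_def by blast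
qed simp

lemma PJ_verts_remove: "PJ_singular l B \<Longrightarrow> card B = m + 2 \<Longrightarrow> b \<in> B \<Longrightarrow> B - {b} \<in> PJ_verts l m"
  unfolding PJ_verts_def using PJ_subset[of l B "B - {b}"] by auto

lemma PJ_verts_insert:
  "PJ_singular l (insert x A) \<Longrightarrow> card A = m \<Longrightarrow> x \<notin> A \<Longrightarrow> insert x A \<in> PJ_verts l m"
  unfolding PJ_verts_def using PJ_finite[of l "insert x A"] by auto

lemma PJ_adj_top:
  assumes "PJ_singular l B" "card B = m + 2" "a \<in> B" "b \<in> B" "a \<noteq> b"
  shows "PJ_adj l m (B - {a}) (B - {b})"
proof -
  have "(B - {a}) \<inter> (B - {b}) = B - {a, b}" "(B - {a}) \<union> (B - {b}) = B" using assms by auto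
  moreover have "card (B - {a, b}) = m" using assms by (subst card_Diff_subset) auto
  ultimately show ?thesis unfolding PJ_adj_def using assms PJ_verts_remove by auto
qed

lemma PJ_adj_star:
  assumes "PJ_singular l (insert i (insert j A))" "card A = m" "i \<notin> A" "j \<notin> A" "i \<noteq> j"
  shows "PJ_adj l m (insert i A) (insert j A)"
proof -
  let ?B = "insert i (insert j A)"
  have "finite A" using PJ_finite[OF assms(1)] by simp
  then have "card ?B = m + 2" using assms by simp
  then have "PJ_adj l m (?B - {j}) (?B - {i})" using PJ_adj_top[of l ?B m j i] assms by auto
  moreover have "?B - {j} = insert i A" "?B - {i} = insert j A" using assms by auto
  ultimately show ?thesis by simp
qed

section \<open>Images of cliques\<close>

text \<open>The map \<open>g\<close> runs from index sets to subspaces, inverse to the given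
  isomorphism. Independence is assumed for arbitrary cliques, as it passes from maximal ones to
  subsets. By \<open>l_ge\<close> adjacency always includes singularity of the union.\<close>

locale pj_embedding = polar_space P L n
  for P :: "'a set" and L :: "'a set set" and n :: nat +
  fixes k l m :: nat and g :: "int set \<Rightarrow> 'a set"
  assumes m_pos: "0 < m" and m_le: "m \<le> k" and l_ge: "m + 3 \<le> l"
    and g_sing: "X \<in> PJ_verts l m \<Longrightarrow> singular_subspace P L (g X) \<and> rk (g X) = k + 1"
    and g_inj: "inj_on g (PJ_verts l m)"
    and g_adj: "X \<in> PJ_verts l m \<Longrightarrow> Y \<in> PJ_verts l m \<Longrightarrow>
      grass_adj P L (int k) (g X) (g Y) \<longleftrightarrow> PJ_adj l m X Y"
    and g_indep: "\<lbrakk>\<C> \<subseteq> PJ_verts l m; \<And>X Y. X \<in> \<C> \<Longrightarrow> Y \<in> \<C> \<Longrightarrow> X \<noteq> Y \<Longrightarrow> PJ_adj l m X Y; X \<in> \<C>\<rbrakk>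
      \<Longrightarrow> g X \<notin> gspan k (g ` \<C> - {g X})"
begin

abbreviation sg :: "int set \<Rightarrow> bool" where "sg \<equiv> PJ_singular l"
abbreviation padj :: "int set \<Rightarrow> int set \<Rightarrow> bool" where "padj \<equiv> PJ_adj l m"

section \<open>Star or top type of vertex triples\<close>

lemma padj_verts: "padj X Y \<Longrightarrow> X \<in> PJ_verts l m \<and> Y \<in> PJ_verts l m"
  by (simp add: PJ_adj_def)

lemma padj_g: "padj X Y \<Longrightarrow> adj k (g X) (g Y)"
  using g_adj padj_verts by blast

lemma padj_sym: "padj X Y \<Longrightarrow> padj Y X"
  unfolding PJ_adj_def by (simp add: Int_commute Un_commute)

lemma padj_D: "padj X Y \<Longrightarrow> card (X \<inter> Y) = m \<and> sg (X \<union> Y)"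
  unfolding PJ_adj_def using l_ge by simp

text \<open>Used for contradictions: vertices whose index sets are visibly non-adjacent cannot share
  a subspace of rank \<open>k + 2\<close>.\<close>

lemma padj_in:
  assumes "sing U" "rk U = k + 2" "X \<in> PJ_verts l m" "g X \<subseteq> U" "Y \<in> PJ_verts l m" "g Y \<subseteq> U" "X \<noteq> Y"
  shows "padj X Y"
proof -
  have "g X \<noteq> g Y" using inj_onD[OF g_inj] assms by blast
  then have "adj k (g X) (g Y)" using adj_in[OF assms(1,2)] g_sing assms by blast
  then show ?thesis using g_adj assms by blast
qed

text \<open>Otherwise the three images would lie on the Grassmann line between the intersection and
  the join of \<open>g X\<close> and \<open>g Y\<close>, and a clique of size three would be
  dependent.\<close>

lemma not_star_and_top:
  assumes "padj X Y" "padj X Z" "padj Y Z" "g X \<inter> g Y \<subseteq> g Z"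
  shows "\<not> g Z \<subseteq> sp (g X \<union> g Y)"
proof
  assume top: "g Z \<subseteq> sp (g X \<union> g Y)"
  have v: "X \<in> PJ_verts l m" "Y \<in> PJ_verts l m" "Z \<in> PJ_verts l m" using assms padj_verts by blast+
  have ne: "g X \<noteq> g Z" "g Y \<noteq> g Z" "g X \<noteq> g Y" using assms padj_g adj_neq by blast+
  have "g Z \<notin> gspan k (g ` {X, Y, Z} - {g Z})"
    by (rule g_indep) (use v assms padj_sym in auto)
  moreover have "g ` {X, Y, Z} - {g Z} = {g X, g Y}" using ne by auto
  moreover have "g Z \<in> gspan k {g X, g Y}"
    unfolding pls_span_def
  proof (rule InterI)
    fix W assume W: "W \<in> {W. gsub k W \<and> {g X, g Y} \<subseteq> W}"
    have a: "adj k (g X) (g Y)" using assms(1) by (rule padj_g)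
    then have S: "sing (g X \<inter> g Y)" "rk (g X \<inter> g Y) = k" using sing_Int2 unfolding adj_iff by auto
    show "g Z \<in> W"
      using gsub_line[OF _ S adj_join[OF a], of W "g X" "g Y" "g Z"] W sub_join ne top assms(4) g_sing[OF v(3)]
      by auto
  qed
  ultimately show False by simp
qed

lemma star_or_top:
  assumes "padj X Y" "padj X Z" "padj Y Z"
  shows "g X \<inter> g Y \<subseteq> g Z \<or> g Z \<subseteq> sp (g X \<union> g Y)"
  using adj_triple[OF padj_g padj_g padj_g] assms by blast

text \<open>If \<open>V\<close> were outside the star it would lie in the top, and
  \<open>adj_four\<close> would force it back into the star; \<open>Z\<close> sticks out of the top
  by \<open>not_star_and_top\<close>.\<close>

lemma star_four:
  assumes "padj X Y" "padj X Z" "padj Y Z" "padj X V" "padj Y V" "padj Z V" "g X \<inter> g Y \<subseteq> g Z"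
  shows "g X \<inter> g Y \<subseteq> g V"
proof (rule ccontr)
  assume "\<not> g X \<inter> g Y \<subseteq> g V"
  then show False
    using adj_four[OF padj_g padj_g padj_g, of X Y Z V] not_star_and_top[of X Y Z]
      star_or_top[of X Y V] assms by blast
qed

text \<open>Only pairwise adjacent triples are covered; \<open>star_Int_subset\<close> extends this
  to an index opposite to \<open>i\<close> or \<open>j\<close>.\<close>

definition stars_ok :: bool where
  "stars_ok \<longleftrightarrow> (\<forall>A i j h. sg (insert i (insert j (insert h A))) \<and> card A = m \<and> distinct [i, j, h] \<and>
     i \<notin> A \<and> j \<notin> A \<and> h \<notin> A \<longrightarrow> g (insert i A) \<inter> g (insert j A) \<subseteq> g (insert h A))"

definition tops_ok :: bool where
  "tops_ok \<longleftrightarrow> (\<forall>B a b c. sg B \<and> card B = m + 2 \<and> {a, b, c} \<subseteq> B \<and> distinct [a, b, c] \<longrightarrow>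
     g (B - {c}) \<subseteq> sp (g (B - {a}) \<union> g (B - {b})))"

lemma top_in_star:
  assumes B: "sg B" "card B = m + 2" "{a, b, c} \<subseteq> B" "distinct [a, b, c]"
    and n: "\<not> g (B - {c}) \<subseteq> sp (g (B - {a}) \<union> g (B - {b}))" and "d \<in> B"
  shows "g (B - {a}) \<inter> g (B - {b}) \<subseteq> g (B - {d})"
proof -
  note t = PJ_adj_top[OF B(1,2)]
  have s: "g (B - {a}) \<inter> g (B - {b}) \<subseteq> g (B - {c})"
    using star_or_top[OF t t t, of a b c] B n by auto
  show ?thesis
  proof (cases "d \<in> {a, b, c}")
    case True then show ?thesis using s by auto
  next
    case False
    then show ?thesis using star_four[OF t t t t t t s, of d] B \<open>d \<in> B\<close> by auto
  qed
qed

text \<open>A failing triple puts all \<open>m + 2\<close> vertices inside \<open>B\<close> into one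
  star. Their independence would then require \<open>k + (m + 2) \<le> n\<close>.\<close>

lemma tops_ok_if_large:
  assumes "n < k + m + 2" shows tops_ok
  unfolding tops_ok_def
proof (intro allI impI, rule ccontr)
  fix B a b c
  assume B: "sg B \<and> card B = m + 2 \<and> {a, b, c} \<subseteq> B \<and> distinct [a, b, c]"
    and n: "\<not> g (B - {c}) \<subseteq> sp (g (B - {a}) \<union> g (B - {b}))"
  have fin: "finite B" using B PJ_finite by blast
  let ?S = "g (B - {a}) \<inter> g (B - {b})" and ?f = "\<lambda>d. B - {d}"
  let ?C = "g ` ?f ` B"
  note t = PJ_adj_top[of l B m]
  have inj: "inj_on ?f B" by (rule inj_onI) blast
  have v: "?f ` B \<subseteq> PJ_verts l m" using PJ_verts_remove B by blast
  have clique: "padj X Y" if "X \<in> ?f ` B" "Y \<in> ?f ` B" "X \<noteq> Y" for X Y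
    using that t B by blast
  have "card (?f ` B) = m + 2" using card_image[OF inj] B by simp
  then have c: "card ?C = m + 2" using card_image[OF inj_on_subset[OF g_inj v]] by simp
  have S: "?S \<subseteq> X" if "X \<in> ?C" for X using that top_in_star[of B a b c] B n by blast
  have a: "adj k (g (B - {a})) (g (B - {b}))" using B by (intro padj_g t) auto
  then have S2: "sing ?S" "rk ?S = k" using sing_Int2 unfolding adj_iff by auto
  have C: "sing X \<and> rk X = k + 1" if "X \<in> ?C" for X using that g_sing v by blast
  \<comment> \<open>Needed to place the whole clique in one singular subspace, where
    \<open>star_card_le\<close> can count it.\<close>
  have col: "col p q" if XY: "X \<in> ?C" "Y \<in> ?C" "p \<in> X" "q \<in> Y" for X Y p q
  proof (cases "X = Y")
    case True
    then show ?thesis using C[OF that(1)] that unfolding singular_subspace_def by blast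
  next
    case False
    obtain X' Y' where "X' \<in> ?f ` B" "Y' \<in> ?f ` B" "X = g X'" "Y = g Y'"
      using XY(1,2) unfolding image_iff[of _ g] by blast
    then have "adj k X Y" using False by (auto intro!: padj_g clique)
    then show ?thesis using that unfolding adj_iff by blast
  qed
  have "\<Union>?C \<subseteq> P" using C sing_carrier by blast
  then have U: "sing (sp (\<Union>?C))"
  proof (rule sp_sing)
    show "col p q" if "p \<in> \<Union>?C" "q \<in> \<Union>?C" for p q using that col by blast
  qed
  have sub: "X \<subseteq> sp (\<Union>?C)" if "X \<in> ?C" for X using that in_sp[of _ "\<Union>?C"] by blast
  have "g (B - {a}) \<in> ?C" using B by simp
  then have SU: "?S \<subseteq> sp (\<Union>?C)" by (intro order_trans[OF Int_lower1 sub])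
  have "k + card ?C \<le> n"
  proof (rule star_card_le[OF _ U S2 SU])
    show "finite ?C" using fin by simp
    show "sing X \<and> rk X = k + 1 \<and> ?S \<subseteq> X \<and> X \<subseteq> sp (\<Union>?C)" if "X \<in> ?C" for X
      using C[OF that] S[OF that] sub[OF that] by simp
    show "X \<notin> gspan k (?C - {X})" if "X \<in> ?C" for X
      using that by (elim imageE[of _ g]) (use g_indep[OF v clique] in blast)
  qed
  then show False using c assms by simp
qed

text \<open>If \<open>insert h A\<close> is not in the star, it lies in the top \<open>?U\<close> of
  \<open>insert i A\<close> and \<open>insert j A\<close>. For \<open>a \<in> A\<close>, available
  since \<open>m > 0\<close>, the vertex \<open>?B - {a}\<close> also lies in \<open>?U\<close>, so
  the two are adjacent; but they share only the \<open>m - 1\<close> elements of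
  \<open>A - {a}\<close>.\<close>

lemma stars_ok_if_tops_ok:
  assumes tops_ok shows stars_ok
  unfolding stars_ok_def
proof (intro allI impI, rule ccontr)
  fix A i j h
  assume A: "sg (insert i (insert j (insert h A))) \<and> card A = m \<and> distinct [i, j, h] \<and>
     i \<notin> A \<and> j \<notin> A \<and> h \<notin> A"
    and n: "\<not> g (insert i A) \<inter> g (insert j A) \<subseteq> g (insert h A)"
  have sub: "sg (insert i (insert j A))" "sg (insert i (insert h A))" "sg (insert j (insert h A))"
    using A by (auto elim!: PJ_subset)
  have fin: "finite A" using PJ_finite[OF sub(1)] by simp
  let ?B = "insert i (insert j A)" and ?U = "sp (g (insert i A) \<union> g (insert j A))"
  have ij: "padj (insert i A) (insert j A)" and ih: "padj (insert i A) (insert h A)"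
    and jh: "padj (insert j A) (insert h A)"
    using A sub by (auto intro!: PJ_adj_star)
  have h: "g (insert h A) \<subseteq> ?U" using star_or_top[OF ij ih jh] n by blast
  obtain a where a: "a \<in> A" using A m_pos by fastforce
  have B: "card ?B = m + 2" using A fin by simp
  have "?B - {j} = insert i A" "?B - {i} = insert j A" using A by auto
  then have Ba: "g (?B - {a}) \<subseteq> ?U"
    using assms[unfolded tops_ok_def, rule_format, of ?B j i a] A a sub B by auto
  have "h \<notin> ?B - {a}" using A by auto
  then have ne: "insert h A \<noteq> ?B - {a}" by blast
  have "padj (insert h A) (?B - {a})"
    using padj_in[OF adj_join[OF padj_g[OF ij]] _ h _ Ba ne] padj_verts[OF ih]
      PJ_verts_remove[OF sub(1) B] a by auto
  moreover have "insert h A \<inter> (?B - {a}) = A - {a}" using A a by auto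
  ultimately have "card (A - {a}) = m" using padj_D by metis
  then show False using A a fin m_pos by simp
qed

text \<open>A further index \<open>e\<close> beyond the \<open>m + 3\<close> present relays the
  failure from \<open>h\<close> to \<open>- h\<close>: by \<open>star_four\<close> it passes from
  \<open>h\<close> to \<open>e\<close>, and from \<open>e\<close> to \<open>- h\<close>. Both
  \<open>insert h A\<close> and \<open>insert (- h) A\<close> then lie in \<open>?U\<close> and
  would be adjacent, although their union contains \<open>h\<close> and \<open>- h\<close>.\<close>

lemma stars_ok_if_four:
  assumes "m + 4 \<le> l" shows stars_ok
  unfolding stars_ok_def
proof (intro allI impI, rule ccontr)
  fix A i j h
  assume A: "sg (insert i (insert j (insert h A))) \<and> card A = m \<and> distinct [i, j, h] \<and>
     i \<notin> A \<and> j \<notin> A \<and> h \<notin> A"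
    and n: "\<not> g (insert i A) \<inter> g (insert j A) \<subseteq> g (insert h A)"
  let ?D = "insert i (insert j (insert h A))" and ?U = "sp (g (insert i A) \<union> g (insert j A))"
  have fin: "finite A" using A PJ_finite[of l ?D] by auto
  then have "card ?D = m + 3" using A by simp
  then obtain e where e: "e \<notin> ?D" "- e \<notin> ?D" "sg (insert e ?D)"
    using PJ_new[of l ?D] A assms by auto
  have A': "i \<notin> A" "j \<notin> A" "h \<notin> A" "i \<noteq> j" "i \<noteq> h" "j \<noteq> h" and cA: "card A = m"
    using A by auto
  have e1: "e \<notin> A" "e \<noteq> i" "e \<noteq> j" "e \<noteq> h" using e(1) by auto
  have D: "sg (insert h (insert i (insert j (insert e A))))" using e(3) by (rule PJ_subset) blast
  have D': "sg (insert (- h) (insert i (insert j (insert e A))))"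
    using D by (rule PJ_flip) (use A' e1 in auto)
  have h': "- h \<notin> A" "- h \<noteq> i" "- h \<noteq> j" "- h \<noteq> h" "- h \<noteq> e"
    using PJ_not_both[OF D, of h] by auto
  have p: "padj (insert x A) (insert y A)"
    if x: "x \<in> {i, j, e, h}" "y \<in> {i, j, e, h}" "x \<noteq> y" for x y
  proof (rule PJ_adj_star[OF _ cA _ _ x(3)])
    show "sg (insert x (insert y A))" using x by (intro PJ_subset[OF D]) blast
  qed (use x A' e1 in auto)
  have p': "padj (insert x A) (insert y A)"
    if x: "x \<in> {i, j, e, - h}" "y \<in> {i, j, e, - h}" "x \<noteq> y" for x y
  proof (rule PJ_adj_star[OF _ cA _ _ x(3)])
    show "sg (insert x (insert y A))" using x by (intro PJ_subset[OF D']) blast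
  qed (use x A' e1 h' in auto)
  have ij: "padj (insert i A) (insert j A)" and ih: "padj (insert i A) (insert h A)"
    and jh: "padj (insert j A) (insert h A)" and ie: "padj (insert i A) (insert e A)"
    and je: "padj (insert j A) (insert e A)" and eh: "padj (insert e A) (insert h A)"
    using A' e1 by (intro p; simp)+
  have ih': "padj (insert i A) (insert (- h) A)" and jh': "padj (insert j A) (insert (- h) A)"
    and he': "padj (insert (- h) A) (insert e A)"
    using h' by (intro p'; force)+
  have "\<not> g (insert i A) \<inter> g (insert j A) \<subseteq> g (insert e A)"
    using star_four[OF ij ie je ih jh eh] n by blast
  then have "\<not> g (insert i A) \<inter> g (insert j A) \<subseteq> g (insert (- h) A)"
    using star_four[OF ij ih' jh' ie je he'] by blast
  then have 1: "g (insert (- h) A) \<subseteq> ?U" using star_or_top[OF ij ih' jh'] by blast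
  have 2: "g (insert h A) \<subseteq> ?U" using star_or_top[OF ij ih jh] n by blast
  have "h \<notin> insert (- h) A" using h' A' by auto
  then have "insert h A \<noteq> insert (- h) A" by blast
  then have "padj (insert h A) (insert (- h) A)"
    using padj_in[OF adj_join[OF padj_g[OF ij]] _ 2 _ 1] padj_verts[OF ih] padj_verts[OF ih'] by blast
  then have "sg (insert h A \<union> insert (- h) A)" using padj_D by blast
  then show False using PJ_not_both[of l "insert h A \<union> insert (- h) A" h] by blast
qed

text \<open>An index \<open>x\<close> opposite to one of \<open>i\<close>, \<open>j\<close> forms no
  triangle with both, so \<open>stars_ok\<close> is used twice, through a third index. It cannot be
  opposite to both, which is why \<open>key\<close> excludes \<open>x = - i\<close> and the
  remaining case swaps \<open>i\<close> and \<open>j\<close>.\<close>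

lemma star_Int_subset:
  assumes ok: stars_ok and A: "card A = m" "i \<notin> A" "j \<notin> A" "i \<noteq> j" "sg (insert i (insert j A))"
    and x: "x \<notin> A" "sg (insert x A)"
  shows "g (insert i A) \<inter> g (insert j A) \<subseteq> g (insert x A)"
proof -
  note st = ok[unfolded stars_ok_def, rule_format]
  have sgx: "1 \<le> \<bar>x\<bar>" "\<bar>x\<bar> \<le> int l" "- x \<notin> A" using x PJ_not_both[OF x(2)] unfolding PJ_singular_def by auto
  have key: "g (insert i A) \<inter> g (insert j A) \<subseteq> g (insert x A)"
    if A: "i \<notin> A" "j \<notin> A" "i \<noteq> j" "sg (insert i (insert j A))" and "x \<noteq> - i" for i j
  proof (cases "x = i \<or> x = j \<or> x \<noteq> - j")
    case True
    then show ?thesis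
    proof (elim disjE)
      assume "x \<noteq> - j"
      then have "sg (insert x (insert i (insert j A)))"
        using that sgx PJ_insert[OF that(4), of x] by auto
      then show ?thesis using st[of i j x A] that assms(2) x by (auto simp: insert_commute)
    qed auto
  next
    case False
    have fin: "finite A" using PJ_finite[OF x(2)] by simp
    \<comment> \<open>Now \<open>x = - j\<close>. The set has \<open>m + 2 < l\<close> elements,
      which leaves an \<open>e\<close> compatible with \<open>i\<close>, \<open>j\<close> and
      \<open>x\<close>.\<close>
    have "card (insert i (insert j A)) < l" using fin A assms(2) l_ge by simp
    then obtain e where e: "e \<notin> insert i (insert j A)" "- e \<notin> insert i (insert j A)"
      "sg (insert e (insert i (insert j A)))" using PJ_new[OF A(4)] by metis
    have "sg (insert i (insert e A))" using e(3) by (rule PJ_subset) auto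
    moreover have ex: "e \<noteq> x" "e \<noteq> - x" using e False by auto
    ultimately have "sg (insert x (insert i (insert e A)))"
      using that sgx PJ_insert[of l "insert i (insert e A)" x] by auto
    then have s2: "g (insert i A) \<inter> g (insert e A) \<subseteq> g (insert x A)"
      using st[of i e x A] that assms(2) x e ex False by (auto simp: insert_commute)
    have s1: "g (insert i A) \<inter> g (insert j A) \<subseteq> g (insert e A)"
      using st[of i j e A] that assms(2) e by (auto simp: insert_commute)
    show ?thesis using s1 s2 by blast
  qed
  show ?thesis
  proof (cases "x = - i")
    case True
    then have "x \<noteq> - j" using A by auto
    then show ?thesis using key[of j i] A by (auto simp: insert_commute)
  qed (use key A in auto)
qed

text \<open>A failing triple makes the clique of \<open>B\<close> a star with base
  \<open>?S\<close>. Exchanges carry \<open>?S\<close> from one \<open>(m + 2)\<close>-set to all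
  others, so \<open>?S\<close> would be the base of a big star containing every vertex.\<close>

lemma tops_ok_if_no_big_star:
  assumes ok: stars_ok
    and no: "\<not> (\<exists>S. sing S \<and> rk S = k \<and> (\<forall>X\<in>PJ_verts l m. S \<subseteq> g X))"
  shows tops_ok
  unfolding tops_ok_def
proof (intro allI impI, rule ccontr)
  fix B a b c
  assume B: "sg B \<and> card B = m + 2 \<and> {a, b, c} \<subseteq> B \<and> distinct [a, b, c]"
    and n: "\<not> g (B - {c}) \<subseteq> sp (g (B - {a}) \<union> g (B - {b}))"
  let ?S = "g (B - {a}) \<inter> g (B - {b})"
  have ab: "adj k (g (B - {a})) (g (B - {b}))" using B by (intro padj_g PJ_adj_top) auto
  then have S: "sing ?S" "rk ?S = k" using sing_Int2 unfolding adj_iff by auto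
  have "?S \<subseteq> g X" if X: "X \<in> PJ_verts l m" for X
  proof -
    have X': "sg X" "card X = m + 1" using X unfolding PJ_verts_def by auto
    have "card X \<le> m + 2" "m + 2 \<le> l" using X' l_ge by auto
    then obtain B' where B': "X \<subseteq> B'" "sg B'" "card B' = m + 2"
      using PJ_extend[OF X'(1)] by metis
    have "\<forall>d\<in>B'. ?S \<subseteq> g (B' - {d})"
    proof (rule PJ_exchange_induct[of l B B' "{}" "\<lambda>B'. \<forall>d\<in>B'. ?S \<subseteq> g (B' - {d})"])
      show "\<forall>d\<in>B. ?S \<subseteq> g (B - {d})" using top_in_star[of B a b c] B n by blast
    next
      fix D x y
      assume D: "sg D" "card D = card B'" "x \<notin> D" "y \<in> D" "sg (insert x (D - {y}))"
        and SD: "\<forall>d\<in>D. ?S \<subseteq> g (D - {d})"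
      have cD: "card D = m + 2" using D B' by simp
      show "\<forall>d\<in>insert x (D - {y}). ?S \<subseteq> g (insert x (D - {y}) - {d})"
      proof
        fix d assume d: "d \<in> insert x (D - {y})"
        show "?S \<subseteq> g (insert x (D - {y}) - {d})"
        proof (cases "d = x")
          case True
          then have "insert x (D - {y}) - {d} = D - {y}" using D by auto
          then show ?thesis using SD D by simp
        next
          case False
          \<comment> \<open>Over this \<open>m\<close>-set the old vertices
            \<open>insert d ?A\<close> and \<open>insert y ?A\<close> contain \<open>?S\<close>, so
            the new vertex \<open>insert x ?A\<close> does too.\<close>
          let ?A = "D - {y, d}"
          have dD: "d \<in> D" "d \<noteq> y" using d False by auto
          have e: "D - {y} = insert d ?A" "D - {d} = insert y ?A"
            "insert x (D - {y}) - {d} = insert x ?A" using D dD False by auto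
          have cA: "card ?A = m" using cD D dD by (subst card_Diff_subset) auto
          have sx: "sg (insert x ?A)" using D(5) by (rule PJ_subset) auto
          have "?S \<subseteq> g (insert d ?A)" unfolding e(1)[symmetric] using SD D by blast
          moreover have "?S \<subseteq> g (insert y ?A)" unfolding e(2)[symmetric] using SD dD by blast
          moreover have "sg (insert d (insert y ?A))" using D(1) by (rule PJ_subset) (use D dD in auto)
          then have "g (insert d ?A) \<inter> g (insert y ?A) \<subseteq> g (insert x ?A)"
            using D dD by (intro star_Int_subset[OF ok cA _ _ _ _ _ sx]) auto
          ultimately have "?S \<subseteq> g (insert x ?A)" by blast
          then show ?thesis by (simp only: e(3))
        qed
      qed
    qed (use B B' in auto)
    moreover obtain d where "d \<in> B'" "X = B' - {d}"
    proof -
      have "card (B' - X) = 1" using B' X' PJ_finite[OF X'(1)] by (simp add: card_Diff_subset)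
      then obtain d where "B' - X = {d}" by (rule card_1_singletonE)
      then show thesis using that[of d] B' by blast
    qed
    ultimately show ?thesis by blast
  qed
  then show False using no S by blast
qed

end

section \<open>Descent to the frame\<close>

lemma two_elements:
  assumes "finite A" "2 \<le> card A" obtains a b where "a \<in> A" "b \<in> A" "a \<noteq> b"
proof -
  have "\<not> card A \<le> Suc 0" using assms(2) by simp
  then show thesis using that card_le_Suc0_iff_eq[OF assms(1)] by blast
qed

context pj_embedding
begin

text \<open>The vertices inside \<open>B\<close> that contain \<open>C\<close> are the
  \<open>B - {b}\<close> with \<open>b \<in> B - C\<close>. Viewing them as coordinate hyperplanes,
  this is the coordinate subspace belonging to \<open>C\<close>.\<close>

definition G :: "int set \<Rightarrow> int set \<Rightarrow> 'a set" where
  "G B C = (\<Inter>b\<in>B - C. g (B - {b}))"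

text \<open>Of the \<open>m + 2\<close> independent hyperplanes, \<open>m + 2 - card C\<close> are
  intersected in rank \<open>k + 2\<close>. The inclusion of \<open>C\<close> is proper because for
  \<open>C = B\<close> the intersection is over nothing; \<open>m \<le> k\<close> makes
  \<open>k - m\<close> a true difference.\<close>

lemma G_rank:
  assumes ok: tops_ok and B: "sg B" "card B = m + 2" and C: "C \<subset> B"
  shows "sing (G B C) \<and> rk (G B C) = k - m + card C"
proof -
  have fin: "finite B" "finite C" using PJ_finite[OF B(1)] C finite_subset by auto
  let ?f = "\<lambda>d. B - {d}"
  let ?C = "g ` ?f ` B" and ?D = "g ` ?f ` (B - C)"
  have inj: "inj_on ?f B" by (rule inj_onI) blast
  have v: "?f ` B \<subseteq> PJ_verts l m" using PJ_verts_remove B by blast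
  have clique: "padj X Y" if "X \<in> ?f ` B" "Y \<in> ?f ` B" "X \<noteq> Y" for X Y
    using that PJ_adj_top[OF B] by blast
  have "card B \<ge> 2" using B by simp
  \<comment> \<open>Any two members serve: \<open>tops_ok\<close> puts all the others into their
    join.\<close>
  then obtain a b where ab: "a \<in> B" "b \<in> B" "a \<noteq> b" using two_elements[OF fin(1)] by blast
  let ?U = "sp (g (B - {a}) \<union> g (B - {b}))"
  have "padj (B - {a}) (B - {b})" using ab PJ_adj_top[OF B] by blast
  note U = adj_join[OF padj_g[OF this]]
  have sub: "g (B - {c}) \<subseteq> ?U" if "c \<in> B" for c
  proof (cases "c = a \<or> c = b")
    case True then show ?thesis
      using sub_join[where X = "g (B - {a})" and Y = "g (B - {b})"] by blast
  next
    case False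
    then show ?thesis using ok[unfolded tops_ok_def, rule_format, of B a b c] B ab that by auto
  qed
  have r: "sing (?U \<inter> \<Inter>?D) \<and> rk (?U \<inter> \<Inter>?D) + card ?D = k + 2"
  proof (rule top_rank[OF _ U])
    show "finite ?C" using fin by simp
    show "?D \<subseteq> ?C" by blast
    fix X assume "X \<in> ?C"
    then obtain c where c: "c \<in> B" "X = g (B - {c})" by blast
    then have "B - {c} \<in> PJ_verts l m" using v by blast
    then show "sing X \<and> rk X = k + 1 \<and> X \<subseteq> ?U" using g_sing sub c by simp
    show "X \<notin> gspan k (?C - {X})" using g_indep[OF v clique, of "B - {c}"] c by simp
  qed
  have "?f ` (B - C) \<subseteq> PJ_verts l m" using v by blast
  then have "card ?D = card (?f ` (B - C))" by (intro card_image inj_on_subset[OF g_inj])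
  also have "\<dots> = card (B - C)" by (intro card_image inj_on_subset[OF inj]) auto
  also have "\<dots> = m + 2 - card C" using C fin B by (simp add: card_Diff_subset psubset_imp_subset)
  finally have cD: "card ?D = m + 2 - card C" .
  obtain c where c: "c \<in> B - C" using C by auto
  have "G B C = \<Inter>?D" unfolding G_def by auto
  moreover have "\<Inter>?D \<subseteq> ?U" using c sub[of c] by auto
  ultimately have "G B C = ?U \<inter> \<Inter>?D" by auto
  moreover have "card C < m + 2" using psubset_card_mono[OF fin(1) C] B by simp
  ultimately show ?thesis using r cD m_le by auto
qed

lemma G_mono: "C \<subseteq> D \<Longrightarrow> G B C \<subseteq> G B D"
  unfolding G_def by blast

lemma G_Int: "C \<inter> D = E \<Longrightarrow> G B C \<inter> G B D = G B E"
  unfolding G_def by auto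

lemma G_remove: "b \<in> B \<Longrightarrow> G B (B - {b}) = g (B - {b})"
proof -
  assume "b \<in> B"
  then have "B - (B - {b}) = {b}" by auto
  then show ?thesis unfolding G_def by simp
qed

lemma top_of_vert:
  assumes "X \<in> PJ_verts l m"
  obtains B b where "sg B" "card B = m + 2" "b \<in> B" "X = B - {b}"
proof -
  have X: "sg X" "card X = m + 1" using assms unfolding PJ_verts_def by auto
  have "card X < l" using X l_ge by simp
  then obtain b where b: "b \<notin> X" "sg (insert b X)" using PJ_new[OF X(1)] by blast
  have "card (insert b X) = m + 2" using b X PJ_finite[OF X(1)] by simp
  then show thesis using that[of "insert b X" b] b by simp
qed

lemma G_subset_g:
  assumes "sg B" "card B = m + 2" "X \<subseteq> B" "card X = m + 1" "C \<subseteq> X"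
  shows "G B C \<subseteq> g X"
proof -
  have "finite X" using assms PJ_finite finite_subset by blast
  then have "card (B - X) = 1" using assms by (simp add: card_Diff_subset)
  then obtain b where "B - X = {b}" by (rule card_1_singletonE)
  then have "b \<in> B" "X = B - {b}" using assms by auto
  then show ?thesis using G_mono[OF assms(5), of B] G_remove by simp
qed

text \<open>With \<open>card C = m\<close>, the two elements of \<open>B - C\<close> present
  \<open>G B C\<close> as the intersection of two members of the star over \<open>C\<close>, to
  which \<open>star_Int_subset\<close> applies.\<close>

lemma G_star_subset:
  assumes ok: stars_ok and B: "sg B" "card B = m + 2" "C \<subseteq> B"
    and B': "sg B'" "card B' = m + 2" "C \<subseteq> B'" and C: "card C = m"
  shows "G B C \<subseteq> G B' C"
  unfolding G_def[of B']
proof (rule INT_greatest)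
  have fin: "finite B" "finite B'" "finite C" using B B' PJ_finite finite_subset by blast+
  fix b assume b: "b \<in> B' - C"
  have two: "card (B - C) = 2" "card (B' - C) = 2"
    using B B' C fin by (simp_all add: card_Diff_subset)
  obtain i j where ij: "B - C = {i, j}" "i \<noteq> j" using two(1) by (meson card_2_iff)
  then have BC: "B = insert i (insert j C)" "i \<notin> C" "j \<notin> C" using B by auto
  obtain x where x: "B' - C = {b, x}" "x \<noteq> b"
  proof -
    obtain x y where "B' - C = {x, y}" "x \<noteq> y" using two(2) by (meson card_2_iff)
    then show thesis using that[of x] that[of y] b by auto
  qed
  then have x': "B' - {b} = insert x C" "x \<notin> C" using B' b by auto
  have "B - {j} = insert i C" "B - {i} = insert j C" using BC ij by auto
  then have "G B C = g (insert i C) \<inter> g (insert j C)" unfolding G_def ij(1) by auto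
  moreover have "sg (insert x C)" using PJ_subset[OF B'(1), of "B' - {b}"] x' by auto
  ultimately show "G B C \<subseteq> g (B' - {b})"
    unfolding x'(1) using star_Int_subset[OF ok C BC(2,3) ij(2)] x'(2) B(1) BC(1) by simp
qed

text \<open>Independence of the choice of \<open>B\<close>, by downward induction on
  \<open>card C\<close>. Below size \<open>m\<close>, a single exchange in \<open>B\<close> is
  handled by writing the subspace of \<open>C\<close> as the intersection of those of
  \<open>insert i C\<close> and \<open>insert j C\<close>.\<close>

lemma G_indep:
  assumes ok: stars_ok and B: "sg B" "card B = m + 2" "C \<subseteq> B"
    and B': "sg B'" "card B' = m + 2" "C \<subseteq> B'" and C: "card C \<le> m + 1"
  shows "G B C = G B' C"
  using B B' C
proof (induction "m + 1 - card C" arbitrary: B B' C rule: less_induct)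
  case less
  have fin: "finite C" using PJ_finite[OF less.prems(1)] less.prems(3) finite_subset by blast
  consider "card C = m + 1" | "card C = m" | "card C < m" using less.prems by linarith
  then show ?case
  proof cases
    case 1
    have "G D C = g C" if D: "sg D" "card D = m + 2" "C \<subseteq> D" for D
    proof -
      have "card (D - C) = 1" using D 1 fin by (simp add: card_Diff_subset)
      then obtain b where "D - C = {b}" by (rule card_1_singletonE)
      then have "b \<in> D" "C = D - {b}" using D by auto
      then show ?thesis using G_remove by simp
    qed
    then show ?thesis using less.prems by simp
  next
    case 2
    then show ?thesis using less.prems by (intro antisym G_star_subset[OF ok]) auto
  next
    case 3
    show ?thesis
    proof (rule PJ_exchange_induct[of l B B' C "\<lambda>D. G B C = G D C"])
      fix D x y
      assume D: "sg D" "C \<subseteq> D" "card D = card B'" "x \<notin> D" "y \<in> D" "y \<notin> C"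
        and D': "sg (insert x (D - {y}))" and eq: "G B C = G D C"
      let ?D = "insert x (D - {y})"
      have fD: "finite D" using D PJ_finite by blast
      have cD: "card D = m + 2" "card ?D = m + 2"
        using D less.prems fD by (simp_all add: card_Suc_Diff1)
      \<comment> \<open>Both \<open>i\<close> and \<open>j\<close> must survive the removal of
        \<open>y\<close>; two such elements exist exactly because \<open>card C < m\<close>.\<close>
      have "card (D - {y} - C) = m + 1 - card C"
        using D cD fin fD by (subst card_Diff_subset) auto
      then have "2 \<le> card (D - {y} - C)" using 3 by simp
      then obtain i j where ij: "i \<in> D - {y} - C" "j \<in> D - {y} - C" "i \<noteq> j"
        using two_elements[of "D - {y} - C"] fD by blast
      have IH: "G D (insert i' C) = G ?D (insert i' C)" if "i' \<in> {i, j}" for i'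
      proof (rule less.hyps)
        show "m + 1 - card (insert i' C) < m + 1 - card C" "card (insert i' C) \<le> m + 1"
          using that ij 3 fin by auto
      qed (use that ij D D' cD in auto)
      have "insert i C \<inter> insert j C = C" using ij by auto
      note e = G_Int[OF this]
      have "G D C = G ?D C" unfolding e[symmetric] using IH by simp
      then show "G B C = G ?D C" using eq by simp
    qed (use less.prems in auto)
  qed
qed

text \<open>The version of \<open>G\<close> that mentions no \<open>B\<close>; they agree by
  \<open>F_eq_G\<close>. The empty set yields \<open>N\<close> and the singletons yield the
  frame.\<close>

definition F :: "int set \<Rightarrow> 'a set" where
  "F C = \<Inter>{g X | X. X \<in> PJ_verts l m \<and> C \<subseteq> X}"

lemma F_eq_G:
  assumes ok: stars_ok and B: "sg B" "card B = m + 2" "C \<subseteq> B" and C: "card C \<le> m + 1"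
  shows "F C = G B C"
proof (rule antisym)
  show "F C \<subseteq> G B C"
    unfolding G_def
  proof (rule INT_greatest)
    fix b assume "b \<in> B - C"
    then have "B - {b} \<in> PJ_verts l m" "C \<subseteq> B - {b}" using PJ_verts_remove B by auto
    then show "F C \<subseteq> g (B - {b})" unfolding F_def by blast
  qed
  show "G B C \<subseteq> F C"
    unfolding F_def
  proof (rule Inter_greatest)
    fix Y assume "Y \<in> {g X |X. X \<in> PJ_verts l m \<and> C \<subseteq> X}"
    then obtain X where X: "Y = g X" "X \<in> PJ_verts l m" "C \<subseteq> X" by blast
    obtain B' b where B': "sg B'" "card B' = m + 2" "b \<in> B'" "X = B' - {b}"
      using top_of_vert[OF X(2)] .
    have "G B C = G B' C" using X B' by (intro G_indep ok B C) auto
    also have "\<dots> \<subseteq> Y" using G_subset_g[OF B'(1,2), of X C] X B' by auto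
    finally show "G B C \<subseteq> Y" .
  qed
qed

section \<open>Coordinate subspaces, their spans and opposite indices\<close>

lemma sg_extend_top:
  assumes "sg C" "card C \<le> m + 2" obtains B where "sg B" "card B = m + 2" "C \<subseteq> B"
proof -
  have "m + 2 \<le> l" using l_ge by simp
  then show ?thesis using PJ_extend[OF assms] that by blast
qed

lemma F_mono: "C \<subseteq> D \<Longrightarrow> F C \<subseteq> F D"
  unfolding F_def by blast

context
  assumes ok: stars_ok tops_ok
begin

lemma F_rank:
  assumes "sg C" "card C \<le> m + 1" shows "sing (F C)" "rk (F C) = k - m + card C"
proof -
  obtain B where B: "sg B" "card B = m + 2" "C \<subseteq> B" using sg_extend_top[of C] assms by auto
  then have "C \<subset> B" using assms by auto
  then show "sing (F C)" "rk (F C) = k - m + card C"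
    using G_rank[OF ok(2) B(1,2)] F_eq_G[OF ok(1) B assms(2)] by auto
qed

lemma F_vert:
  assumes "X \<in> PJ_verts l m" shows "F X = g X"
proof -
  obtain B b where B: "sg B" "card B = m + 2" "b \<in> B" "X = B - {b}" using top_of_vert[OF assms] .
  have "F X = G B X" using B assms by (intro F_eq_G ok) (auto simp: PJ_verts_def)
  then show ?thesis using G_remove B by simp
qed

lemma F_Int:
  assumes "sg (insert j C)" "card C \<le> m + 1" "j \<notin> C" shows "F C \<inter> F {j} = F {}"
proof -
  have "finite C" using PJ_finite[OF assms(1)] by simp
  then have "card (insert j C) \<le> m + 2" using assms by simp
  then obtain B where B: "sg B" "card B = m + 2" "insert j C \<subseteq> B" using sg_extend_top[OF assms(1)] by blast
  have "F C = G B C" "F {j} = G B {j}" "F {} = G B {}"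
    using F_eq_G[OF ok(1) B(1,2)] B(3) assms(2) by simp_all
  moreover have "G B C \<inter> G B {j} = G B {}" using assms by (intro G_Int) auto
  ultimately show ?thesis by simp
qed

lemma F_singleton_new_point:
  assumes "sg {j}" obtains p where "p \<in> F {j}" "p \<notin> F {}"
proof -
  have "\<not> F {j} \<subseteq> F {}"
  proof
    assume "F {j} \<subseteq> F {}"
    then have "rk (F {j}) \<le> rk (F {})" using F_rank assms PJ_subset[OF assms, of "{}"] by (intro rk_mono) auto
    then show False using F_rank[of "{}"] F_rank[of "{j}"] assms PJ_subset[OF assms, of "{}"] by simp
  qed
  then show thesis using that by blast
qed

text \<open>Adding \<open>j\<close> to \<open>C\<close> raises the rank by one, and a point of
  \<open>F {j}\<close> outside \<open>F {}\<close> is outside \<open>F C\<close> by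
  \<open>F_Int\<close>, so it supplies the whole increase. The empty \<open>C\<close> is excluded
  because \<open>F {}\<close> may have positive rank while an empty union spans nothing.\<close>

lemma F_span:
  assumes "C \<noteq> {}" "sg C" "card C \<le> m + 1"
  shows "F C = sp (\<Union>j\<in>C. F {j})"
proof (rule antisym)
  have "finite C" using assms PJ_finite by blast
  show "sp (\<Union>j\<in>C. F {j}) \<subseteq> F C"
    using F_rank[OF assms(2,3)] F_mono[of _ C] by (intro span_least singular_is_subspace) blast+
  show "F C \<subseteq> sp (\<Union>j\<in>C. F {j})"
    using \<open>finite C\<close> assms(1,2,3)
  proof (induction C rule: finite_ne_induct)
    case (singleton j)
    then show ?case using in_sp[of _ "F {j}"] by auto
  next
    case (insert j C)
    have C: "sg C" "sg {j}" using insert.prems by (auto elim!: PJ_subset)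
    have c: "card C \<le> m" using insert by simp
    note FC = F_rank[OF C(1)] and FjC = F_rank[OF insert.prems(1,2)]
    obtain p where p: "p \<in> F {j}" "p \<notin> F {}" using F_singleton_new_point[OF C(2)] .
    then have pC: "p \<notin> F C" using F_Int[of j C] insert c by auto
    have "F {j} \<subseteq> F (insert j C)" "F C \<subseteq> F (insert j C)" by (auto intro!: F_mono subsetD)
    then have e: "sp (insert p (F C)) = F (insert j C)"
      using FC FjC c insert.hyps p pC by (intro sp_insert_eq) auto
    have sP: "(\<Union>j\<in>insert j C. F {j}) \<subseteq> P"
    proof (rule UN_least)
      fix i assume "i \<in> insert j C"
      then have "sg {i}" by (intro PJ_subset[OF insert.prems(1)]) auto
      then show "F {i} \<subseteq> P" using F_rank[of "{i}"] sing_carrier by simp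
    qed
    have "F C \<subseteq> sp (\<Union>j\<in>C. F {j})" using insert C c by simp
    also have "\<dots> \<subseteq> sp (\<Union>j\<in>insert j C. F {j})" by (intro span_mono) auto
    finally have "insert p (F C) \<subseteq> sp (\<Union>j\<in>insert j C. F {j})"
      using p in_sp[of p "\<Union>j\<in>insert j C. F {j}"] by auto
    then show ?case unfolding e[symmetric] by (intro span_least sp_subsp sP)
  qed
qed

text \<open>Take vertices \<open>X\<close> and \<open>?Y\<close> differing only in the sign of
  \<open>j\<close>. If \<open>F {j}\<close> and \<open>F {- j}\<close> lay in one singular subspace,
  all points of \<open>g X\<close> and \<open>g ?Y\<close> would be collinear and the two would meet
  in rank \<open>k\<close>, hence be adjacent; but \<open>X \<union> ?Y\<close> contains both
  \<open>j\<close> and \<open>- j\<close>.\<close>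

lemma F_opposite:
  assumes j: "1 \<le> \<bar>j\<bar>" "\<bar>j\<bar> \<le> int l" and U: "sing U" "F {j} \<subseteq> U" "F {- j} \<subseteq> U"
  shows False
proof -
  have "sg {j}" using j PJ_insert[of l "{}" j] by (simp add: PJ_singular_def)
  then obtain X where X: "{j} \<subseteq> X" "sg X" "card X = m + 1"
    using PJ_extend[of l "{j}" "m + 1"] l_ge by auto
  define A where "A = X - {j}"
  have A: "X = insert j A" "j \<notin> A" "card A = m" "- j \<notin> A"
    using X PJ_not_both[OF X(2), of j] PJ_finite[OF X(2)] unfolding A_def by auto
  let ?Y = "insert (- j) A"
  have Y: "sg ?Y" using PJ_flip[of l j A] X A by auto
  have v: "X \<in> PJ_verts l m" "?Y \<in> PJ_verts l m"
    using PJ_verts_insert[of l _ A m] X Y A by auto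
  then have cX: "card X \<le> m + 1" "card ?Y \<le> m + 1" "?Y \<noteq> {}" "X \<noteq> {}"
    using A by (auto simp: PJ_verts_def)
  let ?P = "\<lambda>Z. \<Union>i\<in>Z. F {i}"
  have span: "g X = sp (?P X)" "g ?Y = sp (?P ?Y)"
    using F_vert v F_span[OF cX(4) X(2) cX(1)] F_span[OF cX(3) Y cX(2)] by simp_all
  have sY: "sing (g ?Y)" "sing (g X)" using v g_sing by auto
  have c1: "col p q" if pq: "p \<in> ?P X" "q \<in> ?P ?Y" for p q
  proof -
    obtain i h where ih: "i \<in> X" "h \<in> ?Y" "p \<in> F {i}" "q \<in> F {h}" using pq by blast
    \<comment> \<open>Apart from the pair \<open>j\<close>, \<open>- j\<close>, one of the two
      indices lies in \<open>A\<close>, so both lie in \<open>X\<close> or both in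
      \<open>?Y\<close>.\<close>
    consider "i = j" "h = - j" | "i \<in> A" | "h \<in> A" using ih A by auto
    then show ?thesis
    proof cases
      case 1
      then show ?thesis using ih U unfolding singular_subspace_def by blast
    next
      case 2
      then have "p \<in> g ?Y" "q \<in> g ?Y" using ih in_sp[of _ "?P ?Y"] span by auto
      then show ?thesis using sY unfolding singular_subspace_def by blast
    next
      case 3
      then have "p \<in> g X" "q \<in> g X" using ih in_sp[of _ "?P X"] span A by auto
      then show ?thesis using sY unfolding singular_subspace_def by blast
    qed
  qed
  have "?P X \<subseteq> g X" "?P ?Y \<subseteq> g ?Y" unfolding span by (rule span_superset)+
  then have PP: "?P X \<subseteq> P" "?P ?Y \<subseteq> P" "g X \<subseteq> P" "g ?Y \<subseteq> P"
    using sing_carrier[OF sY(1)] sing_carrier[OF sY(2)] by blast+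
  have c2: "col p q" if "p \<in> ?P X" "q \<in> g ?Y" for p q
    using sp_perp[OF PP(1,2) c1] that span by auto
  have c3: "col p q" if "p \<in> g ?Y" "q \<in> g X" for p q
    using sp_perp[OF PP(4,1) _ that(1)] c2 that(2) span collinear_sym by metis
  have ne: "X \<noteq> ?Y" using A by (metis PJ_not_both X(2) insertI1)
  have "g X \<noteq> g ?Y" using inj_onD[OF g_inj _ v] ne by blast
  then have "\<not> g X \<subseteq> g ?Y" using rk_eq_imp_eq[of "g ?Y" "g X"] g_sing[OF v(1)] g_sing[OF v(2)] by auto
  then have n: "g X \<inter> g ?Y \<noteq> g X" by blast
  have sI: "sing (g X \<inter> g ?Y)" using sY sing_Int2 by blast
  have "\<not> rk (g X) \<le> rk (g X \<inter> g ?Y)" using rk_eq_imp_eq[of "g X", OF sY(2) sI] n by blast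
  then have "rk (g X \<inter> g ?Y) \<le> k" using g_sing[OF v(1)] by simp
  \<comment> \<open>\<open>F A\<close> lies in both and has rank \<open>k\<close>; distinctness gave
    the other bound.\<close>
  moreover have "k \<le> rk (g X \<inter> g ?Y)"
  proof -
    have sA: "sg A" using X(2) A by (auto elim: PJ_subset)
    have "F A \<subseteq> F X \<inter> F ?Y" using F_mono[of A X] F_mono[of A ?Y] A by blast
    then have "F A \<subseteq> g X \<inter> g ?Y" using F_vert v by simp
    then have "rk (F A) \<le> rk (g X \<inter> g ?Y)" using F_rank[OF sA] A sI by (intro rk_mono) auto
    then show ?thesis using F_rank[OF sA] A m_le by simp
  qed
  ultimately have "adj k (g X) (g ?Y)"
    using c3 collinear_sym g_sing[OF v(1)] g_sing[OF v(2)] unfolding adj_iff by (metis antisym)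
  then have "sg (X \<union> ?Y)" using g_adj v padj_D by blast
  then show False using PJ_not_both[of l "X \<union> ?Y" j] A by auto
qed

lemma frame_exists:
  "\<exists>N \<in> polar_grassmannian P L (int k - int m - 1).
     g ` PJ_verts l m \<subseteq> grass_star P L (int k) N \<and>
     (\<exists>\<B>. point_frame (grass_star P L (int k - int m) N)
            (grass_star_lines P L (int k - int m) N) l \<B> \<and>
          (\<forall>X\<in>g ` PJ_verts l m. \<exists>\<C>\<subseteq>\<B>. X = sp (\<Union>\<C>)))"
proof -
  let ?J = "{j. 1 \<le> \<bar>j\<bar> \<and> \<bar>j\<bar> \<le> int l}" and ?N = "F {}"
  let ?f = "\<lambda>j. F {j}" and ?P = "grass_star P L (int k - int m) (F {})"
    and ?L = "grass_star_lines P L (int k - int m) (F {})"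
  let ?\<B> = "?f ` ?J"
  have sg0: "sg {}" by (simp add: PJ_singular_def)
  have sg1: "sg {j}" if "j \<in> ?J" for j using that PJ_insert[OF sg0, of j] by simp
  have sg2: "sg {i, j}" if "i \<in> ?J" "j \<in> ?J" "i \<noteq> - j" for i j
    using that PJ_insert[OF sg1[of j], of i] by (simp add: minus_equation_iff)
  have N: "?N \<in> polar_grassmannian P L (int k - int m - 1)"
    using F_rank[OF sg0] m_le unfolding grassmannian_iff by simp
  have pt: "?f j \<in> ?P" if "j \<in> ?J" for j
    using F_rank[OF sg1[OF that]] m_le F_mono[of "{}" "{j}"]
    unfolding grass_star_def grassmannian_iff by auto
  have col: "pls_collinear ?L (?f i) (?f j)" if ij: "i \<in> ?J" "j \<in> ?J" "i \<noteq> - j" for i j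
  proof (cases "i = j")
    case False
    let ?U = "F {i, j}"
    have c: "card {i, j} = 2" using False by simp
    \<comment> \<open>The subspace spanned by two frame points has
      \<open>card {i, j} = 2 \<le> m + 1\<close>, by \<open>m > 0\<close>, so \<open>F_rank\<close>
      applies and \<open>?N\<close>, \<open>?U\<close> bound a line of the star.\<close>
    have U: "?U \<in> polar_grassmannian P L (int k - int m + 1)"
      using F_rank[OF sg2[OF ij]] m_le m_pos unfolding grassmannian_iff c by auto
    have NU: "?N \<subseteq> ?U" by (rule F_mono) simp
    then have "grass_interval P L (int k - int m) ?N ?U \<in> ?L"
      unfolding grass_star_lines_def using N U by blast
    moreover have "?f h \<in> grass_interval P L (int k - int m) ?N ?U" if "h \<in> {i, j}" for h
      using pt[of h] that ij F_mono[of "{h}" "{i, j}"] unfolding grass_interval_def grass_star_def by auto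
    ultimately show ?thesis unfolding pls_collinear_def by blast
  qed (simp add: pls_collinear_def)
  \<comment> \<open>A line through both would have an upper end that is a singular subspace
    containing \<open>F {j}\<close> and \<open>F {- j}\<close>, against
    \<open>F_opposite\<close>.\<close>
  have ncol: "\<not> pls_collinear ?L (?f j) (?f (- j))" if j: "j \<in> ?J" for j
  proof
    have nU: "\<not> (sing U \<and> ?f j \<subseteq> U \<and> ?f (- j) \<subseteq> U)" for U using F_opposite[of j U] j by blast
    assume "pls_collinear ?L (?f j) (?f (- j))"
    then consider "?f j = ?f (- j)" | l where "l \<in> ?L" "?f j \<in> l" "?f (- j) \<in> l"
      unfolding pls_collinear_def by blast
    then show False
    proof cases
      case 1
      then show ?thesis using nU[of "?f j"] F_rank(1)[OF sg1[OF j]] by simp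
    next
      case 2
      then show ?thesis using nU
        unfolding grass_star_lines_def grass_interval_def polar_grassmannian_def by blast
    qed
  qed
  have Jm: "- j \<in> ?J" if "j \<in> ?J" for j using that by simp
  have inj: "inj_on ?f ?J"
  proof (rule inj_onI, rule ccontr)
    fix i j assume ij: "i \<in> ?J" "j \<in> ?J" "?f i = ?f j" "i \<noteq> j"
    show False
    proof (cases "i = - j")
      case True
      then show ?thesis using ncol[OF ij(2)] ij(3) unfolding pls_collinear_def by simp
    next
      case False
      then have "?f j \<inter> ?f i = ?N" using F_Int[of i "{j}"] sg2[of i j] ij by auto
      then have "?f j = ?N" using ij(3) by simp
      moreover obtain p where "p \<in> ?f j" "p \<notin> ?N" using F_singleton_new_point[OF sg1[OF ij(2)]] .
      ultimately show ?thesis by simp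
    qed
  qed
  have Jeq: "?J = {1..int l} \<union> uminus ` {1..int l}"
  proof (intro equalityI subsetI)
    fix x assume x: "x \<in> ?J"
    then have "x \<in> {1..int l} \<or> - x \<in> {1..int l}" by auto
    then show "x \<in> {1..int l} \<union> uminus ` {1..int l}" by (metis UnI1 UnI2 image_eqI minus_minus)
  qed auto
  then have finJ: "finite ?J" by simp
  have "card ?J = 2 * l"
    unfolding Jeq by (subst card_Un_disjoint) (auto simp: card_image)
  then have card: "card ?\<B> = 2 * l" using card_image[OF inj] by simp
  have frame: "point_frame ?P ?L l ?\<B>"
    unfolding point_frame_def
  proof (intro conjI ballI)
    show "?\<B> \<subseteq> ?P" using pt by blast
    show "finite ?\<B>" using finJ by simp
    show "card ?\<B> = 2 * l" by (rule card)
    fix p assume "p \<in> ?\<B>"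
    then obtain i where i: "i \<in> ?J" "p = ?f i" by blast
    show "\<exists>!q. q \<in> ?\<B> \<and> q \<noteq> p \<and> \<not> pls_collinear ?L p q"
    proof (rule ex1I[of _ "?f (- i)"])
      have "?f (- i) \<noteq> ?f i" using ncol[OF i(1)] unfolding pls_collinear_def by metis
      then show "?f (- i) \<in> ?\<B> \<and> ?f (- i) \<noteq> p \<and> \<not> pls_collinear ?L p (?f (- i))"
        using i ncol[OF i(1)] Jm by blast
    next
      fix q assume q: "q \<in> ?\<B> \<and> q \<noteq> p \<and> \<not> pls_collinear ?L p q"
      then obtain j where j: "j \<in> ?J" "q = ?f j" by blast
      then have "i = - j" using col[OF i(1) j(1)] q i by blast
      then show "q = ?f (- i)" using j by simp
    qed
  qed
  have star: "g ` PJ_verts l m \<subseteq> grass_star P L (int k) ?N"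
    using g_sing F_vert F_mono[of "{}"] unfolding grass_star_def grassmannian_iff by fastforce
  have "\<exists>\<C>\<subseteq>?\<B>. X = sp (\<Union>\<C>)" if X: "X \<in> g ` PJ_verts l m" for X
  proof -
    obtain V where V: "V \<in> PJ_verts l m" "X = g V" using X by blast
    then have "sg V" "card V \<le> m + 1" "V \<noteq> {}" by (auto simp: PJ_verts_def)
    then have "X = sp (\<Union>(?f ` V))" "V \<subseteq> ?J" using F_span[of V] F_vert V by (auto simp: PJ_singular_def)
    then show ?thesis by (intro exI[of _ "?f ` V"] conjI image_mono)
  qed
  then show ?thesis using N star frame by blast
qed

end

end

text \<open>The theorem assumes independence of maximal cliques, while the argument uses cliques of
  sizes three and \<open>m + 2\<close>; finiteness of the vertex set connects the two.\<close>

lemma clique_in_maximal: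
  assumes "finite V" "graph_clique V E C"
  obtains M where "maximal_graph_clique V E M" "C \<subseteq> M"
proof -
  have "finite {D. graph_clique V E D}"
    using assms(1) by (rule rev_finite_subset[OF finite_Pow_iff[THEN iffD2]]) (auto simp: graph_clique_def)
  then obtain M where "M \<in> {D. graph_clique V E D}" "C \<subseteq> M"
    "\<forall>D\<in>{D. graph_clique V E D}. M \<subseteq> D \<longrightarrow> M = D"
    using finite_has_maximal2[of "{D. graph_clique V E D}" C] assms(2) by auto
  then show thesis using that unfolding maximal_graph_clique_def by blast
qed

theorem theorem4p5:
  fixes P :: "'a set" and L :: "'a set set" and n k l m :: nat and \<X> :: "'a set set"
  assumes "polar_space P L n" and "n \<ge> 3"
    and "0 < m" and "m \<le> k" and "l \<le> n" and "3 \<le> l - m" and "l - m \<le> n - k"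
    and "\<X> \<subseteq> polar_grassmannian P L (int k)"
    and "graph_isomorphic \<X> (grass_adj P L (int k)) (PJ_verts l m) (PJ_adj l m)"
    and "\<And>C. maximal_graph_clique \<X> (grass_adj P L (int k)) C \<Longrightarrow>
           pls_independent (polar_grassmannian P L (int k)) (grass_lines P L (int k)) C"
    and "m + 2 > n - k \<or>
         (l - m \<ge> 4 \<and> \<not> (\<exists>S \<in> polar_grassmannian P L (int k - 1). \<X> \<subseteq> grass_star P L (int k) S))"
  shows "\<exists>N \<in> polar_grassmannian P L (int k - int m - 1).
           \<X> \<subseteq> grass_star P L (int k) N \<and>
           (\<exists>\<B>. point_frame (grass_star P L (int k - int m) N)
                  (grass_star_lines P L (int k - int m) N) l \<B> \<and>
                (\<forall>X\<in>\<X>. \<exists>\<C>\<subseteq>\<B>. X = pls_span P L (\<Union>\<C>)))"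
proof -
  interpret polar_space P L n by (rule assms(1))
  obtain f where f: "bij_betw f \<X> (PJ_verts l m)"
    "\<And>x y. x \<in> \<X> \<Longrightarrow> y \<in> \<X> \<Longrightarrow> adj k x y \<longleftrightarrow> PJ_adj l m (f x) (f y)"
    using assms(9) unfolding graph_isomorphic_def by blast
  define g where "g = inv_into \<X> f"
  have g: "bij_betw g (PJ_verts l m) \<X>" unfolding g_def using f(1) by (rule bij_betw_inv_into)
  have fg: "f (g X) = X" if "X \<in> PJ_verts l m" for X
    unfolding g_def using bij_betw_inv_into_right[OF f(1) that] .
  have gX: "g ` PJ_verts l m = \<X>" using g by (simp add: bij_betw_def)
  have g_adj: "adj k (g X) (g Y) \<longleftrightarrow> PJ_adj l m X Y"
    if "X \<in> PJ_verts l m" "Y \<in> PJ_verts l m" for X Y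
    using f(2)[of "g X" "g Y"] that gX fg by auto
  have finX: "finite \<X>" unfolding gX[symmetric] using PJ_verts_finite by simp
  have "pj_embedding P L n k l m g"
  proof unfold_locales
    show "0 < m" "m \<le> k" "m + 3 \<le> l" using assms by auto
    show "inj_on g (PJ_verts l m)" using g by (simp add: bij_betw_def)
    show "sing (g X) \<and> rk (g X) = k + 1" if "X \<in> PJ_verts l m" for X
      using that assms(8) gX grassmannian_iff[of "g X" "int k"] by auto
    show "adj k (g X) (g Y) \<longleftrightarrow> PJ_adj l m X Y"
      if "X \<in> PJ_verts l m" "Y \<in> PJ_verts l m" for X Y using g_adj[OF that] .
    fix \<C> X
    assume C: "\<C> \<subseteq> PJ_verts l m" "X \<in> \<C>"
      and adj: "\<And>X Y. X \<in> \<C> \<Longrightarrow> Y \<in> \<C> \<Longrightarrow> X \<noteq> Y \<Longrightarrow> PJ_adj l m X Y"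
    have "graph_clique \<X> (adj k) (g ` \<C>)"
      unfolding graph_clique_def
    proof (intro conjI ballI impI)
      show "g ` \<C> \<subseteq> \<X>" using C gX by blast
      fix x y assume "x \<in> g ` \<C>" "y \<in> g ` \<C>" "x \<noteq> y"
      then obtain X Y where XY: "X \<in> \<C>" "Y \<in> \<C>" "x = g X" "y = g Y" "X \<noteq> Y" by blast
      then show "adj k x y" using g_adj[of X Y] adj[of X Y] C by blast
    qed
    then obtain M where M: "maximal_graph_clique \<X> (adj k) M" "g ` \<C> \<subseteq> M"
      using clique_in_maximal[OF finX] by blast
    \<comment> \<open>Independence is inherited: an element outside the span of the rest of
      \<open>M\<close> is outside the span of fewer elements.\<close>
    have "g X \<notin> gspan k (M - {g X})"
      using assms(10)[OF M(1)] M(2) C unfolding independent_iff by blast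
    then show "g X \<notin> gspan k (g ` \<C> - {g X})"
      using span_mono[of "g ` \<C> - {g X}" "M - {g X}"] M(2) by blast
  qed
  then interpret pj_embedding P L n k l m g .
  \<comment> \<open>The cases run in opposite orders: in case 1 the count gives tops and these give
    stars, in case 2 the extra index gives stars and the absence of a big star gives tops.\<close>
  have "stars_ok \<and> tops_ok"
  proof (cases "m + 2 > n - k")
    case True
    then have "n < k + m + 2" by simp
    then have tops_ok by (rule tops_ok_if_large)
    then show ?thesis using stars_ok_if_tops_ok by simp
  next
    case False
    then have h: "m + 4 \<le> l" "\<not> (\<exists>S \<in> polar_grassmannian P L (int k - 1). \<X> \<subseteq> grass_star P L (int k) S)"
      using assms(11) by auto
    have stars_ok using h(1) by (rule stars_ok_if_four)
    moreover have "\<not> (\<exists>S. sing S \<and> rk S = k \<and> (\<forall>X\<in>PJ_verts l m. S \<subseteq> g X))"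
    proof
      assume "\<exists>S. sing S \<and> rk S = k \<and> (\<forall>X\<in>PJ_verts l m. S \<subseteq> g X)"
      then obtain S where S: "sing S" "rk S = k" "\<forall>X\<in>PJ_verts l m. S \<subseteq> g X" by blast
      then have "S \<in> polar_grassmannian P L (int k - 1)" by (simp add: grassmannian_iff)
      moreover have "\<X> \<subseteq> grass_star P L (int k) S"
        using S assms(8) gX unfolding grass_star_def by blast
      ultimately show False using h(2) by blast
    qed
    ultimately show ?thesis using tops_ok_if_no_big_star by blast
  qed
  then show ?thesis using frame_exists gX by simp
qed

end
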